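(* Let $b\geq 2$ be an integer and let $A=(a_n)_{n=1}^{\infty}$ be a strictly increasing sequence of positive integers with $\eta:=\limsup_{n\to\infty}\frac{a_{n+1}}{a_n}<+\infty$. If $\eta=1$, then for any $\hat v\in(0,1)$ and $\theta\ge\frac{1}{1-\hat v}$, $$\dim_{\rm H}\big(\hat{\mathcal V}^{\ast}_{b,A}(\hat v)\cap\mathcal V^{\ast}_{b,A}(\theta\hat v)\big)=\dim_{\rm H}\big(\hat{\mathcal V}_{b,A}(\hat v)\cap\mathcal V^{\ast}_{b,A}(\theta\hat v)\big)=\frac{\theta-1-\theta\hat v}{(\theta-1)(1+\theta\hat v)}.$$
   Context: $\|x\|$ denotes the distance from $x\in\mathbb R$ to the nearest integer; $\dim_{\rm H}$ is Hausdorff dimension. For real $\xi$, $$v_{b,A}(\xi):=\sup\{v\ge 0:\ \|b^{a_n}\xi\|<(b^{a_n})^{-v}\ \text{for infinitely many } n\in\mathbb N\}\in[0,+\infty],$$ $$\hat v_{b,A}(\xi):=\sup\Big\{\hat v\ge 0:\ \text{for all sufficiently large integers }N,\ \min_{1\le n\le N}\|b^{a_n}\xi\|<(b^{a_N})^{-\hat v}\Big\}\in[0,+\infty].$$ (The exponents are introduced for irrational $\xi$; for rational $\xi$ the same formulas are used.) For $v\in[0,+\infty]$, $\mathcal V^{\ast}_{b,A}(v):=\{\xi\in\mathbb R:v_{b,A}(\xi)=v\}$, and for $\hat v\in[0,\eta]$, $\hat{\mathcal V}_{b,A}(\hat v):=\{\xi\in\mathbb R:\hat v_{b,A}(\xi)\ge\hat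 v\}$ and $\hat{\mathcal V}^{\ast}_{b,A}(\hat v):=\{\xi\in\mathbb R:\hat v_{b,A}(\xi)=\hat v\}$. *)

theory Defs
  imports "HOL-Analysis.Analysis"
begin

text \<open>
  Summand of the \<open>s\<close>-dimensional Hausdorff measure for one covering set. The usual
  conventions are that the empty set contributes \<open>0\<close> and that \<open>d\<^sup>0 = 1\<close> for nonempty sets
  even when the diameter \<open>d\<close> is \<open>0\<close>, whereas \<open>0 powr 0 = 0\<close> in HOL.
\<close>

definition hausdorff_gauge :: "real \<Rightarrow> 'a::metric_space set \<Rightarrow> ennreal" where
  "hausdorff_gauge s U =
     (if U = {} then 0 else if s = 0 then 1 else ennreal (diameter U powr s))"

text \<open>
  Boundedness of the covering sets is required explicitly because \<^const>\<open>diameter\<close> is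
  real-valued and carries no information for unbounded sets.
\<close>

definition hausdorff_premeasure :: "real \<Rightarrow> real \<Rightarrow> 'a::metric_space set \<Rightarrow> ennreal" where
  "hausdorff_premeasure s \<delta> E =
     Inf {\<Sum>i. hausdorff_gauge s (U i) | U :: nat \<Rightarrow> 'a set.
            E \<subseteq> (\<Union>i. U i) \<and> (\<forall>i. bounded (U i) \<and> diameter (U i) \<le> \<delta>)}"

definition hausdorff_measure :: "real \<Rightarrow> 'a::metric_space set \<Rightarrow> ennreal" where
  "hausdorff_measure s E = (SUP \<delta>\<in>{0<..}. hausdorff_premeasure s \<delta> E)"

text \<open>With this definition the empty set has dimension \<open>0\<close>.\<close>

definition hausdorff_dim :: "'a::metric_space set \<Rightarrow> ereal" where
  "hausdorff_dim E = Inf {ereal s | s. 0 \<le> s \<and> hausdorff_measure s E = 0}"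

definition dist_nearest_int :: "real \<Rightarrow> real" where
  "dist_nearest_int x = \<bar>x - of_int (round x)\<bar>"

text \<open>
  Sequences are indexed from \<open>1\<close>; the value \<open>a 0\<close> never plays a role.
\<close>

definition growth_ratio :: "(nat \<Rightarrow> nat) \<Rightarrow> ereal" where
  "growth_ratio a = limsup (\<lambda>n. ereal (real (a (Suc n)) / real (a n)))"

definition v_exp :: "nat \<Rightarrow> (nat \<Rightarrow> nat) \<Rightarrow> real \<Rightarrow> ereal" where
  "v_exp b a \<xi> =
     Sup {ereal v | v. 0 \<le> v \<and>
       infinite {n. 1 \<le> n \<and>
         dist_nearest_int (real b ^ a n * \<xi>) < (real b ^ a n) powr (- v)}}"

definition v_hat_exp :: "nat \<Rightarrow> (nat \<Rightarrow> nat) \<Rightarrow> real \<Rightarrow> ereal" where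
  "v_hat_exp b a \<xi> =
     Sup {ereal w | w. 0 \<le> w \<and>
       (\<forall>\<^sub>F N in sequentially.
         Min ((\<lambda>n. dist_nearest_int (real b ^ a n * \<xi>)) ` {1..N}) < (real b ^ a N) powr (- w))}"

definition V_star :: "nat \<Rightarrow> (nat \<Rightarrow> nat) \<Rightarrow> ereal \<Rightarrow> real set" where
  "V_star b a v = {\<xi>. v_exp b a \<xi> = v}"

definition V_hat :: "nat \<Rightarrow> (nat \<Rightarrow> nat) \<Rightarrow> ereal \<Rightarrow> real set" where
  "V_hat b a w = {\<xi>. v_hat_exp b a \<xi> \<ge> w}"

definition V_hat_star :: "nat \<Rightarrow> (nat \<Rightarrow> nat) \<Rightarrow> ereal \<Rightarrow> real set" where
  "V_hat_star b a w = {\<xi>. v_hat_exp b a \<xi> = w}"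

end

theory Submission
  imports Defs
begin

text \<open>
  Since consecutive terms of \<open>A\<close> have ratio tending to one, both exponents only depend on the
  numbers \<open>\<parallel>b\<^sup>n \<xi>\<parallel>\<close> for all \<open>n\<close>, that is, on the long runs of the digits \<open>0\<close> and \<open>b - 1\<close> of \<open>\<xi>\<close>.
  Upper bound: if a run starts at \<open>N\<close>, the uniform exponent forces an earlier run which starts at
  some \<open>r \<ge> N / \<theta>\<close>, has length at least \<open>w N\<close> and ends before \<open>N\<close>. Hence the number \<open>c N\<close> of
  prefixes of length \<open>N\<close> satisfies \<open>c N \<lesssim> (\<Sum>r \<in> {N / \<theta>..N}. c r * b\<^bsup>(1 - w) N - r\<^esup>)\<close>, which gives
  the growth rate \<open>(\<theta> - 1 - \<theta> w) / (\<theta> - 1)\<close>; infinitely many of these prefixes are followed by a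
  run of length about \<open>\<theta> w N\<close>, and a Borel--Cantelli covering concludes.
  Lower bound: in a large base \<open>B = b\<^sup>D\<close>, take the digit \<open>0\<close> at the positions in
  \<open>[\<theta>\<^sup>k, (1 + \<theta> w) \<theta>\<^sup>k)\<close> and arbitrary digits in \<open>{1..B - 2}\<close> elsewhere.
\<close>

section \<open>Hausdorff measure\<close>

text \<open>Trying c r = b^(\<gamma> r) with \<gamma> < 1 in the counting recursion, the summand
  b^((1 - w) N - (1 - \<gamma>) r) is largest at the smallest admissible r, about N / \<theta>; the
  condition 1 - w - (1 - \<gamma>) / \<theta> < \<gamma> rearranges to \<gamma> > 1 - \<theta> w /
  (\<theta> - 1). The factor 1 + \<theta> w in the denominator of the dimension is the decay rate of
  the covering intervals. The obstacle is that both exponents are suprema, possibly not attained and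
  with no constant common to all points. So they are perturbed by a small \<epsilon>, and the set is
  split into countably many pieces on each of which one constant q serves every point. Below, the
  exponents must be exact, so free digits may not create runs. Excluding 0 and B - 1 costs a factor
  log (B - 2) / log B, which tends to 1 only for large bases; in base 2 no digit would be left. The
  block length \<theta> w \<theta>^k is forced: just before the next block, at N near
  \<theta>^(k+1), it equals w N.\<close>

lemma hausdorff_gauge_empty [simp]: "hausdorff_gauge s {} = 0"
  by (simp add: hausdorff_gauge_def)

lemma hausdorff_measure_eq_0_iff:
  "hausdorff_measure s E = 0 \<longleftrightarrow> (\<forall>\<delta>>0. hausdorff_premeasure s \<delta> E = 0)"
  unfolding hausdorff_measure_def by (auto simp: SUP_eq_iff bot_ennreal intro!: SUP_eq_const)

lemma hausdorff_premeasure_le: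
  assumes "E \<subseteq> (\<Union>i. U i)" and "\<And>i. bounded (U i) \<and> diameter (U i) \<le> \<delta>"
  shows "hausdorff_premeasure s \<delta> E \<le> (\<Sum>i. hausdorff_gauge s (U i))"
  unfolding hausdorff_premeasure_def by (rule Inf_lower) (use assms in auto)

text \<open>Serves both for countable unions of sets and for covers that come in levels of finitely
  many pieces.\<close>

lemma hausdorff_premeasure_le_double:
  fixes U :: "nat \<Rightarrow> nat \<Rightarrow> 'a::metric_space set"
  assumes cov: "E \<subseteq> (\<Union>i. \<Union>j. U i j)"
    and U: "\<And>i j. bounded (U i j) \<and> diameter (U i j) \<le> \<delta>"
  shows "hausdorff_premeasure s \<delta> E \<le> (\<Sum>i. \<Sum>j. hausdorff_gauge s (U i j))"
proof -
  define V where "V = (\<lambda>i. case prod_decode i of (i, j) \<Rightarrow> U i j)"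
  have "E \<subseteq> (\<Union>i. V i)"
  proof
    fix x assume "x \<in> E"
    then obtain i j where "x \<in> U i j" using cov by blast
    then have "x \<in> V (prod_encode (i, j))" by (simp add: V_def)
    then show "x \<in> (\<Union>i. V i)" by blast
  qed
  then have "hausdorff_premeasure s \<delta> E \<le> (\<Sum>i. hausdorff_gauge s (V i))"
    by (rule hausdorff_premeasure_le) (auto simp: V_def U split: prod.split)
  also have "\<dots> = (\<Sum>i. \<Sum>j. hausdorff_gauge s (U i j))"
    using suminf_ennreal_2dimen[where f="\<lambda>(i, j). hausdorff_gauge s (U i j)"
        and g="\<lambda>i. \<Sum>j. hausdorff_gauge s (U i j)"]
    by (simp add: V_def case_prod_unfold)
  finally show ?thesis .
qed

lemma hausdorff_premeasure_mono:
  assumes "E \<subseteq> F"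
  shows "hausdorff_premeasure s \<delta> E \<le> hausdorff_premeasure s \<delta> F"
  unfolding hausdorff_premeasure_def by (rule Inf_superset_mono) (use assms in blast)

lemma hausdorff_measure_null_mono:
  assumes "E \<subseteq> F" and "hausdorff_measure s F = 0"
  shows "hausdorff_measure s E = 0"
  using hausdorff_premeasure_mono[OF assms(1), of s] assms(2)
  unfolding hausdorff_measure_eq_0_iff by (metis le_zero_eq)

lemma hausdorff_dim_mono: "E \<subseteq> F \<Longrightarrow> hausdorff_dim E \<le> hausdorff_dim F"
  unfolding hausdorff_dim_def
  by (rule Inf_superset_mono) (auto intro: hausdorff_measure_null_mono)

lemma hausdorff_dim_nonneg: "0 \<le> hausdorff_dim E"
  unfolding hausdorff_dim_def by (rule Inf_greatest) auto

lemma hausdorff_dim_leI: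
  assumes "0 \<le> s" and "\<And>t. s < t \<Longrightarrow> hausdorff_measure t E = 0"
  shows "hausdorff_dim E \<le> ereal s"
proof (rule ereal_le_epsilon2)
  fix e :: real assume "0 < e"
  then have "hausdorff_measure (s + e) E = 0" by (intro assms) simp
  then have "hausdorff_dim E \<le> ereal (s + e)"
    unfolding hausdorff_dim_def using \<open>0 < e\<close> assms(1) by (intro Inf_lower) auto
  then show "hausdorff_dim E \<le> ereal s + ereal e" by simp
qed

lemma hausdorff_measure_UN_null:
  fixes E :: "nat \<Rightarrow> 'a::metric_space set"
  assumes null: "\<And>i. hausdorff_measure s (E i) = 0"
  shows "hausdorff_measure s (\<Union>i. E i) = 0"
  unfolding hausdorff_measure_eq_0_iff
proof (intro allI impI)
  fix \<delta> :: real assume "0 < \<delta>"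
  show "hausdorff_premeasure s \<delta> (\<Union>i. E i) = 0"
  proof (rule ccontr)
    assume "hausdorff_premeasure s \<delta> (\<Union>i. E i) \<noteq> 0"
    then have "0 < hausdorff_premeasure s \<delta> (\<Union>i. E i)" by (simp add: zero_less_iff_neq_zero)
    \<comment> \<open>The premeasure may be infinite, so a finite positive error budget strictly
      below it is chosen and distributed geometrically over the sets \<open>E i\<close>.\<close>
    then obtain c' where c': "0 < c'" "c' < hausdorff_premeasure s \<delta> (\<Union>i. E i)"
      using dense by blast
    moreover from c'(2) have "c' \<noteq> top" using top.not_eq_extremum by fastforce
    ultimately obtain c :: real where "c' = ennreal c" "0 \<le> c"
      by (cases c' rule: ennreal_cases) blast+
    with c' have c: "0 < c" "ennreal c < hausdorff_premeasure s \<delta> (\<Union>i. E i)"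
      by auto
    have "\<exists>U. (E i \<subseteq> (\<Union>j. U j) \<and> (\<forall>j. bounded (U j) \<and> diameter (U j) \<le> \<delta>))
            \<and> (\<Sum>j. hausdorff_gauge s (U j)) < ennreal (c * (1/2) ^ Suc i)" for i
    proof -
      have "hausdorff_premeasure s \<delta> (E i) = 0"
        using null \<open>0 < \<delta>\<close> by (simp add: hausdorff_measure_eq_0_iff)
      then have "hausdorff_premeasure s \<delta> (E i) < ennreal (c * (1/2) ^ Suc i)"
        using c(1) by (auto simp: ennreal_less_zero_iff)
      then show ?thesis unfolding hausdorff_premeasure_def Inf_less_iff by blast
    qed
    then obtain U where U: "\<And>i. E i \<subseteq> (\<Union>j. U i j)"
      "\<And>i j. bounded (U i j) \<and> diameter (U i j) \<le> \<delta>"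
      "\<And>i. (\<Sum>j. hausdorff_gauge s (U i j)) < ennreal (c * (1/2) ^ Suc i)"
      by metis
    have "hausdorff_premeasure s \<delta> (\<Union>i. E i) \<le> (\<Sum>i. \<Sum>j. hausdorff_gauge s (U i j))"
    proof (rule hausdorff_premeasure_le_double[OF _ U(2)])
      show "(\<Union>i. E i) \<subseteq> (\<Union>i. \<Union>j. U i j)" by (intro UN_mono order_refl U(1))
    qed
    also have "\<dots> \<le> (\<Sum>i. ennreal (c * (1/2) ^ Suc i))"
      by (intro suminf_le order.strict_implies_order U) auto
    also have "\<dots> = ennreal c"
      using sums_mult[OF power_half_series, of c] c(1) by (intro suminf_ennreal_eq) auto
    finally show False using c(2) by simp
  qed
qed

text \<open>A Borel--Cantelli argument: every tail of the covering system is a cover.\<close>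

lemma hausdorff_measure_limsup_null:
  fixes S :: "nat \<Rightarrow> 'b set" and I :: "nat \<Rightarrow> 'b \<Rightarrow> real set"
  assumes s: "0 < s"
    and fin: "\<And>r. finite (S r)"
    and I: "\<And>r x. bounded (I r x)" "\<And>r x. diameter (I r x) \<le> \<rho> r"
    and \<rho>: "\<rho> \<longlonglongrightarrow> 0"
    and summ: "summable (\<lambda>r. real (card (S r)) * \<rho> r powr s)"
    and cov: "\<And>\<xi>. \<xi> \<in> E \<Longrightarrow> infinite {r. \<exists>x\<in>S r. \<xi> \<in> I r x}"
  shows "hausdorff_measure s E = 0"
  unfolding hausdorff_measure_eq_0_iff
proof (intro allI impI)
  fix \<delta> :: real assume "0 < \<delta>"
  define f where "f = (\<lambda>r. real (card (S r)) * \<rho> r powr s)"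
  have \<rho>0: "0 \<le> \<rho> r" for r using I diameter_ge_0 order_trans by blast
  have ex: "\<exists>R. \<forall>r\<ge>R. \<rho> r \<le> \<delta>"
    using order_tendstoD(2)[OF \<rho> \<open>0 < \<delta>\<close>] unfolding eventually_sequentially
    by (meson less_imp_le)
  have le: "hausdorff_premeasure s \<delta> E \<le> ennreal e" if "e > 0" for e
  proof -
    obtain R1 where R1: "\<And>r. r \<ge> R1 \<Longrightarrow> \<rho> r \<le> \<delta>" using ex by blast
    obtain R2 where R2: "\<And>n. n \<ge> R2 \<Longrightarrow> norm (\<Sum>i. f (i + n)) < e"
      using suminf_exist_split[OF \<open>e > 0\<close>, of f] summ unfolding f_def by blast
    define R where "R = max R1 R2"
    have "\<exists>l. set l = S r \<and> length l = card (S r)" for r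
      using finite_distinct_list[OF fin[of r]] distinct_card by fastforce
    then obtain l where l: "\<And>r. set (l r) = S r" "\<And>r. length (l r) = card (S r)" by metis
    \<comment> \<open>The tail of the system from level \<open>R\<close> on, with each finite level
      padded by empty sets, which have gauge 0.\<close>
    define U where "U = (\<lambda>i j. if j < card (S (i + R)) then I (i + R) (l (i + R) ! j) else {})"
    have "E \<subseteq> (\<Union>i. \<Union>j. U i j)"
    proof
      fix \<xi> assume "\<xi> \<in> E"
      then obtain r x where "R \<le> r" "x \<in> S r" "\<xi> \<in> I r x"
        using cov unfolding infinite_nat_iff_unbounded_le by blast
      then obtain j where "j < card (S r)" "l r ! j = x"
        using l by (metis in_set_conv_nth)
      then have "\<xi> \<in> U (r - R) j" using \<open>R \<le> r\<close> \<open>\<xi> \<in> I r x\<close> by (simp add: U_def)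
      then show "\<xi> \<in> (\<Union>i. \<Union>j. U i j)" by blast
    qed
    moreover have "bounded (U i j) \<and> diameter (U i j) \<le> \<delta>" for i j
      using I[of "i + R" "l (i + R) ! j"] R1[of "i + R"] \<open>0 < \<delta>\<close>
        order_trans[OF I(2)[of "i + R" "l (i + R) ! j"], of \<delta>]
      by (simp add: U_def R_def)
    ultimately have "hausdorff_premeasure s \<delta> E \<le> (\<Sum>i. \<Sum>j. hausdorff_gauge s (U i j))"
      by (rule hausdorff_premeasure_le_double)
    also have "\<dots> \<le> (\<Sum>i. ennreal (f (i + R)))"
    proof (intro suminf_le)
      fix i
      have g: "hausdorff_gauge s (U i j) \<le> ennreal (\<rho> (i + R) powr s)" for j
        using s I[of "i + R" "l (i + R) ! j"] 
        by (auto simp: hausdorff_gauge_def U_def intro!: ennreal_leI powr_mono2 diameter_ge_0)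
      have "(\<Sum>j. hausdorff_gauge s (U i j)) = (\<Sum>j<card (S (i + R)). hausdorff_gauge s (U i j))"
        by (intro suminf_finite) (auto simp: U_def)
      also have "\<dots> \<le> (\<Sum>j<card (S (i + R)). ennreal (\<rho> (i + R) powr s))"
        by (intro sum_mono g)
      also have "\<dots> = ennreal (f (i + R))"
        by (simp add: f_def ennreal_mult ennreal_of_nat_eq_real_of_nat)
      finally show "(\<Sum>j. hausdorff_gauge s (U i j)) \<le> ennreal (f (i + R))" .
    qed auto
    also have "\<dots> = ennreal (\<Sum>i. f (i + R))"
      using summable_ignore_initial_segment[OF summ, of R]
      by (intro suminf_ennreal2) (simp_all add: f_def)
    also have "\<dots> \<le> ennreal e"
      using R2[of R] by (intro ennreal_leI) (simp add: R_def)
    finally show ?thesis .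
  qed
  have "hausdorff_premeasure s \<delta> E \<le> 0"
  proof (rule ennreal_le_epsilon)
    fix e :: real assume "0 < e"
    then show "hausdorff_premeasure s \<delta> E \<le> 0 + ennreal e" using le by simp
  qed
  then show "hausdorff_premeasure s \<delta> E = 0" by simp
qed

section \<open>Distance to the nearest integer along powers of the base\<close>

lemma dist_nearest_int_nonneg: "0 \<le> dist_nearest_int x"
  by (simp add: dist_nearest_int_def)

lemma dist_nearest_int_le_half: "dist_nearest_int x \<le> 1 / 2"
  unfolding dist_nearest_int_def using of_int_round_abs_le[of x] by linarith

lemma dist_nearest_int_le: "dist_nearest_int x \<le> \<bar>x - of_int m\<bar>"
  unfolding dist_nearest_int_def by (rule round_diff_minimal)

lemma dist_nearest_int_mult: "dist_nearest_int (real k * x) \<le> real k * dist_nearest_int x"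
proof -
  have "dist_nearest_int (real k * x) \<le> \<bar>real k * x - of_int (int k * round x)\<bar>"
    by (rule dist_nearest_int_le)
  also have "\<dots> = real k * dist_nearest_int x"
    by (simp add: dist_nearest_int_def abs_mult flip: right_diff_distrib)
  finally show ?thesis .
qed

text \<open>While the scaled error stays below 1/2, k times the nearest integer is still the nearest
  integer. This gives the exact growth by the factor b inside a run.\<close>

lemma dist_nearest_int_mult_eq:
  assumes "real k * dist_nearest_int x < 1 / 2"
  shows "dist_nearest_int (real k * x) = real k * dist_nearest_int x"
proof -
  have eq: "\<bar>real k * x - of_int (int k * round x)\<bar> = real k * dist_nearest_int x"
    by (simp add: dist_nearest_int_def abs_mult flip: right_diff_distrib)
  then have "round (real k * x) = int k * round x"
    using assms by (intro round_unique') simp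
  then show ?thesis using eq by (simp add: dist_nearest_int_def)
qed

lemma dist_nearest_int_add_int:
  assumes "0 \<le> t" "t \<le> 1"
  shows "min t (1 - t) \<le> dist_nearest_int (of_int m + t)"
proof -
  define z where "z = round (of_int m + t) - m"
  have "dist_nearest_int (of_int m + t) = \<bar>t - of_int z\<bar>"
    by (simp add: dist_nearest_int_def z_def algebra_simps)
  moreover have "z \<le> 0 \<or> 1 \<le> z" by linarith
  then have "(of_int z :: real) \<le> 0 \<or> 1 \<le> (of_int z :: real)" by linarith
  ultimately show ?thesis by (auto simp: min_def abs_if)
qed

text \<open>A value of size about b^(-L) means that a run of about L digits 0, or of about L digits
  b - 1, begins at position n.\<close>

definition pow_dist :: "nat \<Rightarrow> real \<Rightarrow> nat \<Rightarrow> real" where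
  "pow_dist b \<xi> n = dist_nearest_int (real b ^ n * \<xi>)"

lemma pow_dist_nonneg: "0 \<le> pow_dist b \<xi> n"
  by (simp add: pow_dist_def dist_nearest_int_nonneg)

lemma pow_dist_le_half: "pow_dist b \<xi> n \<le> 1 / 2"
  unfolding pow_dist_def by (rule dist_nearest_int_le_half)

text \<open>The basic way to move between positions: it carries smallness forwards and, read in
  reverse, lower bounds backwards, at the cost of b^j.\<close>

lemma pow_dist_add_le: "pow_dist b \<xi> (n + j) \<le> real b ^ j * pow_dist b \<xi> n"
  using dist_nearest_int_mult[of "b ^ j" "real b ^ n * \<xi>"]
  by (simp add: pow_dist_def power_add mult_ac)

lemma pow_dist_le_powr:
  assumes "2 \<le> b" "n \<le> m"
  shows "pow_dist b \<xi> m \<le> real b powr (real m - real n) * pow_dist b \<xi> n"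
proof -
  have "real b powr (real m - real n) = real b ^ (m - n)"
    using assms by (simp add: powr_realpow flip: of_nat_diff)
  then show ?thesis using pow_dist_add_le[of b \<xi> n "m - n"] assms by simp
qed

lemma pow_dist_power_base: "pow_dist (b ^ D) \<xi> j = pow_dist b \<xi> (D * j)"
  by (simp add: pow_dist_def power_mult)

section \<open>Sequences with growth ratio one\<close>

locale dense_sequence =
  fixes b :: nat and a :: "nat \<Rightarrow> nat"
  assumes b: "2 \<le> b"
    and mono: "strict_mono_on {1..} a"
    and pos: "\<And>n. 1 \<le> n \<Longrightarrow> 0 < a n"
    and ratio: "growth_ratio a = 1"
begin

lemma powr_mono': "x \<le> y \<Longrightarrow> real b powr x \<le> real b powr y"
  using b by (intro powr_mono) auto

lemma powr_less': "real b powr x < real b powr y \<longleftrightarrow> x < y"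
  using b by (intro powr_less_cancel_iff) auto

lemma a_powr: "(real b ^ a n) powr x = real b powr (real (a n) * x)"
  using b by (simp add: powr_powr flip: powr_realpow)

lemma a_less: "1 \<le> i \<Longrightarrow> i < j \<Longrightarrow> a i < a j"
  using mono by (auto simp: strict_mono_on_def)

lemma a_le_iff: "1 \<le> i \<Longrightarrow> 1 \<le> j \<Longrightarrow> a i \<le> a j \<longleftrightarrow> i \<le> j"
  using a_less by (metis le_less_linear less_le_not_le linorder_cases order_refl)

lemma a_inj: "inj_on a {1..}"
  using mono by (rule strict_mono_on_imp_inj_on)

lemma a_ge: "1 \<le> i \<Longrightarrow> i \<le> a i"
proof (induction i rule: nat_induct_at_least)
  case base
  then show ?case using pos[of 1] by simp
next
  case (Suc n)
  then show ?case using a_less[of n "Suc n"] by simp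
qed

text \<open>For the least admissible index i with \<open>n \<le> a i\<close>, the preceding term is
  below n and the ratio of the two is below 1 + \<epsilon>. The constant \<open>Q\<close> absorbs
  the case where i is the first admissible index, so that every n is covered.\<close>

lemma next_term:
  assumes "0 < \<epsilon>"
  obtains Q where "0 \<le> Q"
    "\<And>n. \<exists>i\<ge>i0. 1 \<le> i \<and> n \<le> a i \<and> real (a i) \<le> (1 + \<epsilon>) * real n + Q"
proof -
  have "limsup (\<lambda>n. ereal (real (a (Suc n)) / real (a n))) < ereal (1 + \<epsilon>)"
    using ratio assms by (simp add: growth_ratio_def)
  then have "\<forall>\<^sub>F n in sequentially. ereal (real (a (Suc n)) / real (a n)) < ereal (1 + \<epsilon>)"
    by (rule Limsup_lessD)
  then obtain i1 where i1: "\<And>n. n \<ge> i1 \<Longrightarrow> real (a (Suc n)) / real (a n) < 1 + \<epsilon>"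
    by (auto simp: eventually_sequentially)
  \<comment> \<open>The index stays at least 1 because \<open>a 0\<close> is arbitrary and may
    vanish.\<close>
  define i2 where "i2 = max (max i0 i1) 1"
  show ?thesis
  proof (rule that[of "real (a i2)"])
    fix n :: nat
    define i where "i = (LEAST i. i2 \<le> i \<and> n \<le> a i)"
    have "i2 \<le> max n i2 \<and> n \<le> a (max n i2)"
      using a_ge[of "max n i2"] by (auto simp: i2_def)
    then have i: "i2 \<le> i" "n \<le> a i" unfolding i_def by (metis (mono_tags, lifting) LeastI)+
    have "real (a i) \<le> (1 + \<epsilon>) * real n + real (a i2)"
    proof (cases "i = i2")
      case True
      then show ?thesis using assms by simp
    next
      case False
      then have "i2 \<le> i - 1" "i - 1 < i" using i by auto
      then have "\<not> n \<le> a (i - 1)" unfolding i_def using not_less_Least by blast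
      have "0 < a (i - 1)" using \<open>i2 \<le> i - 1\<close> pos by (auto simp: i2_def)
      moreover have "real (a (Suc (i - 1))) / real (a (i - 1)) < 1 + \<epsilon>"
        using \<open>i2 \<le> i - 1\<close> by (intro i1) (auto simp: i2_def)
      ultimately have "real (a i) \<le> (1 + \<epsilon>) * real (a (i - 1))"
        using \<open>i - 1 < i\<close> by (simp add: divide_less_eq)
      also have "\<dots> \<le> (1 + \<epsilon>) * real n"
        using assms \<open>\<not> n \<le> a (i - 1)\<close> by (intro mult_left_mono) auto
      finally show ?thesis by simp
    qed
    then show "\<exists>i\<ge>i0. 1 \<le> i \<and> n \<le> a i \<and> real (a i) \<le> (1 + \<epsilon>) * real n + real (a i2)"
      using i by (intro exI[of _ i]) (auto simp: i2_def)
  qed simp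
qed

lemma previous_term:
  assumes "0 < \<epsilon>"
  obtains Q where "0 \<le> Q"
    "\<And>N. Q \<le> real N \<Longrightarrow> \<exists>i\<ge>i0. 1 \<le> i \<and> a i \<le> N \<and> real N \<le> (1 + \<epsilon>) * real (a i) + Q"
proof -
  obtain Q where Q: "0 \<le> Q"
    "\<And>n. \<exists>i\<ge>i0. 1 \<le> i \<and> n \<le> a i \<and> real (a i) \<le> (1 + \<epsilon>) * real n + Q"
    using next_term[OF assms] by blast
  show ?thesis
  proof (rule that[of "Q + 1 + \<epsilon>"])
    fix N :: nat assume N: "Q + 1 + \<epsilon> \<le> real N"
    \<comment> \<open>The largest n for which the term following n, as found by
      \<open>next_term\<close>, is certain not to exceed N.\<close>
    define n where "n = nat \<lfloor>(real N - Q) / (1 + \<epsilon>)\<rfloor>"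
    have "0 \<le> (real N - Q) / (1 + \<epsilon>)" using N assms by simp
    then have n: "real n \<le> (real N - Q) / (1 + \<epsilon>)" "(real N - Q) / (1 + \<epsilon>) < real n + 1"
      unfolding n_def by linarith+
    have n1: "(1 + \<epsilon>) * real n + Q \<le> real N" "real N < (1 + \<epsilon>) * (real n + 1) + Q"
      using n assms by (simp_all add: field_simps)
    obtain i where i: "i \<ge> i0" "1 \<le> i" "n \<le> a i" "real (a i) \<le> (1 + \<epsilon>) * real n + Q"
      using Q(2) by blast
    have "(1 + \<epsilon>) * real n \<le> (1 + \<epsilon>) * real (a i)" using i assms by (intro mult_left_mono) auto
    then have "real N \<le> (1 + \<epsilon>) * real (a i) + (Q + 1 + \<epsilon>)"
      using n1 by (simp add: algebra_simps)
    moreover have "a i \<le> N" using i n1 by linarith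
    ultimately show "\<exists>i\<ge>i0. 1 \<le> i \<and> a i \<le> N \<and> real N \<le> (1 + \<epsilon>) * real (a i) + (Q + 1 + \<epsilon>)"
      using i by blast
  qed (use Q assms in auto)
qed

end

section \<open>Translation between the exponents along A and bounds at all integer positions\<close>

context dense_sequence
begin

lemma pow_dist_le: "n \<le> m \<Longrightarrow> pow_dist b \<xi> m \<le> real b powr (real m - real n) * pow_dist b \<xi> n"
  using b by (rule pow_dist_le_powr)

lemma v_exp_eq:
  "v_exp b a \<xi> = Sup {ereal v | v. 0 \<le> v \<and>
     infinite {i. 1 \<le> i \<and> pow_dist b \<xi> (a i) < real b powr (- v * real (a i))}}"
  unfolding v_exp_def by (simp add: a_powr pow_dist_def mult.commute)

lemma v_hat_exp_eq:
  "v_hat_exp b a \<xi> = Sup {ereal u | u. 0 \<le> u \<and>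
     (\<forall>\<^sub>F I in sequentially. \<exists>i. 1 \<le> i \<and> i \<le> I \<and>
        pow_dist b \<xi> (a i) < real b powr (- u * real (a I)))}"
proof -
  have "(\<forall>\<^sub>F I in sequentially. Min ((\<lambda>n. dist_nearest_int (real b ^ a n * \<xi>)) ` {1..I})
            < (real b ^ a I) powr (- u)) \<longleftrightarrow>
        (\<forall>\<^sub>F I in sequentially. \<exists>i. 1 \<le> i \<and> i \<le> I \<and>
            pow_dist b \<xi> (a i) < real b powr (- u * real (a I)))" for u
  \<comment> \<open>For I = 0 the set under \<open>Min\<close> is empty, so the equivalence is only
    claimed eventually.\<close>
  proof (rule eventually_cong[OF eventually_ge_at_top[of 1]])
    fix I :: nat assume "1 \<le> I"
    then have "Min ((\<lambda>n. dist_nearest_int (real b ^ a n * \<xi>)) ` {1..I}) < (real b ^ a I) powr (- u)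
      \<longleftrightarrow> (\<exists>i\<in>{1..I}. dist_nearest_int (real b ^ a i * \<xi>) < (real b ^ a I) powr (- u))"
      by (subst Min_less_iff) auto
    then show "Min ((\<lambda>n. dist_nearest_int (real b ^ a n * \<xi>)) ` {1..I}) < (real b ^ a I) powr (- u)
      \<longleftrightarrow> (\<exists>i. 1 \<le> i \<and> i \<le> I \<and> pow_dist b \<xi> (a i) < real b powr (- u * real (a I)))"
      by (auto simp: a_powr pow_dist_def mult.commute)
  qed
  then show ?thesis unfolding v_hat_exp_def by simp
qed

text \<open>All but finitely many terms of A satisfy a lower bound with some u < v'. The bound is
  pulled back from the next late term to n, and \<open>q\<close> pays for the bounded part of the
  distance, which makes the result valid for every n.\<close>

lemma v_exp_upperD:
  assumes "v_exp b a \<xi> = ereal v" "0 \<le> v" "v < v'"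
  obtains q where "0 \<le> q" "\<And>n. real b powr (- v' * real n - q) \<le> pow_dist b \<xi> n"
proof -
  obtain u where u: "v < u" "u < v'" using assms(3) dense by blast
  have fin: "finite {i. 1 \<le> i \<and> pow_dist b \<xi> (a i) < real b powr (- u * real (a i))}"
  proof (rule ccontr)
    assume "infinite {i. 1 \<le> i \<and> pow_dist b \<xi> (a i) < real b powr (- u * real (a i))}"
    then have "ereal u \<le> v_exp b a \<xi>"
      unfolding v_exp_eq using u assms by (intro Sup_upper) auto
    then show False using u assms by simp
  qed
  obtain i0 where i0: "\<forall>i\<in>{i. 1 \<le> i \<and> pow_dist b \<xi> (a i) < real b powr (- u * real (a i))}. i \<le> i0"
    using fin unfolding finite_nat_set_iff_bounded_le by blast
  \<comment> \<open>Pulling the bound back from \<open>a i\<close> to n yields the exponent n - (1 +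
    u) \<open>a i\<close>; this \<epsilon> turns (1 + u) (1 + \<epsilon>) into exactly 1 +
    v'.\<close>
  define \<epsilon> where "\<epsilon> = (v' - u) / (1 + u)"
  have \<epsilon>: "0 < \<epsilon>" "(1 + u) * (1 + \<epsilon>) = 1 + v'"
    using u assms by (simp_all add: \<epsilon>_def field_simps)
  obtain Q where Q: "0 \<le> Q"
    "\<And>n. \<exists>i\<ge>Suc i0. 1 \<le> i \<and> n \<le> a i \<and> real (a i) \<le> (1 + \<epsilon>) * real n + Q"
    using next_term[OF \<epsilon>(1)] by blast
  show ?thesis
  proof (rule that[of "(1 + u) * Q"])
    fix n
    obtain i where i: "Suc i0 \<le> i" "1 \<le> i" "n \<le> a i" "real (a i) \<le> (1 + \<epsilon>) * real n + Q"
      using Q by blast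
    have "\<not> pow_dist b \<xi> (a i) < real b powr (- u * real (a i))"
    proof
      assume "pow_dist b \<xi> (a i) < real b powr (- u * real (a i))"
      then have "i \<le> i0" using i0 i(2) by simp
      then show False using i(1) by simp
    qed
    then have "real b powr (- u * real (a i)) \<le> pow_dist b \<xi> (a i)" by simp
    also have "\<dots> \<le> real b powr (real (a i) - real n) * pow_dist b \<xi> n"
      using i by (intro pow_dist_le)
    finally have "real b powr (- (real (a i) - real n)) * real b powr (- u * real (a i))
        \<le> real b powr (- (real (a i) - real n)) *
            (real b powr (real (a i) - real n) * pow_dist b \<xi> n)"
      by (intro mult_left_mono) auto
    also have "\<dots> = pow_dist b \<xi> n"
      using b by (simp add: powr_add[symmetric] mult.assoc[symmetric])
    finally have *: "real b powr (real n - (1 + u) * real (a i)) \<le> pow_dist b \<xi> n"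
      by (simp add: powr_add[symmetric] algebra_simps)
    have "(1 + u) * real (a i) \<le> (1 + u) * ((1 + \<epsilon>) * real n + Q)"
      using i u assms by (intro mult_left_mono) auto
    also have "\<dots> = (1 + v') * real n + (1 + u) * Q"
      using \<epsilon>(2) by (simp add: distrib_left flip: mult.assoc)
    finally have "- v' * real n - (1 + u) * Q \<le> real n - (1 + u) * real (a i)"
      by (simp add: algebra_simps)
    with * show "real b powr (- v' * real n - (1 + u) * Q) \<le> pow_dist b \<xi> n"
      using powr_mono' order_trans by blast
  qed (use Q u assms in auto)
qed

lemma v_exp_lowerD:
  assumes "ereal v \<le> v_exp b a \<xi>" "v' < v"
  shows "infinite {n. pow_dist b \<xi> n < real b powr (- v' * real n)}"
proof -
  have "ereal v' < v_exp b a \<xi>" using assms by (meson ereal_less(2) less_ereal.simps(1) order_less_le_trans)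
  then obtain u where u: "v' < u" "0 \<le> u"
    "infinite {i. 1 \<le> i \<and> pow_dist b \<xi> (a i) < real b powr (- u * real (a i))}"
    unfolding v_exp_eq less_Sup_iff by auto
  let ?S = "{i. 1 \<le> i \<and> pow_dist b \<xi> (a i) < real b powr (- u * real (a i))}"
  have "infinite (a ` ?S)"
    using u(3) finite_imageD inj_on_subset[OF a_inj, of ?S] by blast
  moreover have "a ` ?S \<subseteq> {n. pow_dist b \<xi> n < real b powr (- v' * real n)}"
  proof clarify
    fix i assume "pow_dist b \<xi> (a i) < real b powr (- u * real (a i))"
    also have "\<dots> \<le> real b powr (- v' * real (a i))"
      using u by (intro powr_mono') (simp add: mult_right_mono)
    finally show "pow_dist b \<xi> (a i) < real b powr (- v' * real (a i))" .
  qed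
  ultimately show ?thesis using finite_subset by blast
qed

text \<open>The uniform property is applied at the last term of A not exceeding N; since that term
  is nearly N, only the passage from u to w' is lost.\<close>

lemma v_hat_exp_lowerD:
  assumes "ereal w \<le> v_hat_exp b a \<xi>" "w' < w" "0 < w'"
  obtains q where "0 \<le> q" "\<And>N. \<exists>n\<le>N. pow_dist b \<xi> n < real b powr (- w' * real N + q)"
proof -
  have "ereal w' < v_hat_exp b a \<xi>" using assms by (meson ereal_less(2) less_ereal.simps(1) order_less_le_trans)
  then obtain u where u: "w' < u"
    "\<forall>\<^sub>F I in sequentially. \<exists>i. 1 \<le> i \<and> i \<le> I \<and> pow_dist b \<xi> (a i) < real b powr (- u * real (a I))"
    unfolding v_hat_exp_eq less_Sup_iff by auto
  then obtain i0 where i0: "\<And>I. i0 \<le> I \<Longrightarrow>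
      \<exists>i. 1 \<le> i \<and> i \<le> I \<and> pow_dist b \<xi> (a i) < real b powr (- u * real (a I))"
    unfolding eventually_sequentially by blast
  define \<epsilon> where "\<epsilon> = u / w' - 1"
  have \<epsilon>: "0 < \<epsilon>" "w' * (1 + \<epsilon>) = u" using u assms by (simp_all add: \<epsilon>_def field_simps)
  obtain Q where Q: "0 \<le> Q"
    "\<And>N. Q \<le> real N \<Longrightarrow> \<exists>i\<ge>i0. 1 \<le> i \<and> a i \<le> N \<and> real N \<le> (1 + \<epsilon>) * real (a i) + Q"
    using previous_term[OF \<epsilon>(1)] by blast
  show ?thesis
  proof (rule that[of "w' * Q"])
    fix N
    show "\<exists>n\<le>N. pow_dist b \<xi> n < real b powr (- w' * real N + w' * Q)"
    proof (cases "Q \<le> real N")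
      case True
      then obtain I where I: "i0 \<le> I" "1 \<le> I" "a I \<le> N" "real N \<le> (1 + \<epsilon>) * real (a I) + Q"
        using Q by blast
      obtain i where i: "1 \<le> i" "i \<le> I" "pow_dist b \<xi> (a i) < real b powr (- u * real (a I))"
        using i0 I by blast
      have "w' * real N \<le> w' * ((1 + \<epsilon>) * real (a I) + Q)" using I assms by (intro mult_left_mono) auto
      also have "\<dots> = u * real (a I) + w' * Q" using \<epsilon>(2) by (simp add: distrib_left flip: mult.assoc)
      finally have "real b powr (- u * real (a I)) \<le> real b powr (- w' * real N + w' * Q)"
        by (intro powr_mono') simp
      moreover have "a i \<le> N" using a_le_iff[of i I] i I by auto
      ultimately show ?thesis using i by (intro exI[of _ "a i"]) simp
    next
      case False
      \<comment> \<open>For small N the right-hand side is at least 1, while every distance is at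
        most 1/2.\<close>
      have "real b powr 0 \<le> real b powr (- w' * real N + w' * Q)"
        using False assms by (intro powr_mono') (simp add: mult_left_mono)
      then have "1 \<le> real b powr (- w' * real N + w' * Q)" using b by simp
      then show ?thesis using pow_dist_le_half[of b \<xi> 0] by (intro exI[of _ 0]) linarith
    qed
  qed (use Q assms in auto)
qed

lemma v_exp_leI:
  assumes lb: "\<And>n. real b powr (- v * real n - q) \<le> pow_dist b \<xi> n"
  shows "v_exp b a \<xi> \<le> ereal v"
  unfolding v_exp_eq
proof (rule Sup_least, clarify)
  fix u assume inf: "infinite {i. 1 \<le> i \<and> pow_dist b \<xi> (a i) < real b powr (- u * real (a i))}"
  show "ereal u \<le> ereal v"
  proof (rule ccontr)
    assume "\<not> ereal u \<le> ereal v"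
    then have uv: "v < u" by simp
    have "i \<le> nat \<lceil>q / (u - v)\<rceil>"
      if "1 \<le> i" "pow_dist b \<xi> (a i) < real b powr (- u * real (a i))" for i
    proof -
      have "real b powr (- v * real (a i) - q) < real b powr (- u * real (a i))"
        using lb that(2) by (rule order.strict_trans1)
      then have "real (a i) * (u - v) < q" by (simp add: powr_less' algebra_simps)
      then have "real (a i) < q / (u - v)" using uv by (simp add: pos_less_divide_eq)
      then show ?thesis using a_ge[OF that(1)] by linarith
    qed
    then have "{i. 1 \<le> i \<and> pow_dist b \<xi> (a i) < real b powr (- u * real (a i))}
        \<subseteq> {..nat \<lceil>q / (u - v)\<rceil>}" by auto
    then show False using inf finite_subset by blast
  qed
qed

text \<open>A small value at n stays small at the next term of A, since that term lies within
  \<epsilon> n + \<open>Q\<close> of n.\<close>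

lemma v_exp_geI:
  assumes v: "0 < v"
    and inf: "infinite {n. pow_dist b \<xi> n \<le> real b powr (- v * real n + q)}"
  shows "ereal v \<le> v_exp b a \<xi>"
proof (rule ereal_le_epsilon2)
  fix e :: real assume e: "0 < e"
  \<comment> \<open>The supremum ranges over nonnegative exponents only, hence the truncation at
    0.\<close>
  define u where "u = max 0 (v - e)"
  have u: "0 \<le> u" "u < v" "v - e \<le> u" using v e by (auto simp: u_def)
  \<comment> \<open>Half of the gap v - u pays for moving to the next term; the other half,
    multiplied by a large n, beats the additive constants.\<close>
  define \<epsilon> where "\<epsilon> = (v - u) / (2 * (1 + u))"
  have \<epsilon>: "0 < \<epsilon>" "(1 + u) * (1 + \<epsilon>) = 1 + (u + v) / 2" using u by (simp_all add: \<epsilon>_def field_simps)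
  obtain Q where Q: "0 \<le> Q"
    "\<And>n. \<exists>i\<ge>1. 1 \<le> i \<and> n \<le> a i \<and> real (a i) \<le> (1 + \<epsilon>) * real n + Q"
    using next_term[OF \<epsilon>(1), of 1] by blast
  have "infinite {i. 1 \<le> i \<and> pow_dist b \<xi> (a i) < real b powr (- u * real (a i))}"
    (is "infinite ?S")
  proof
    assume "finite ?S"
    then have "finite (a ` ?S)" by (rule finite_imageI)
    then obtain k where "\<forall>m\<in>a ` ?S. m \<le> k" unfolding finite_nat_set_iff_bounded_le by blast
    then have k: "a i \<le> k" if "i \<in> ?S" for i using that by simp
    define n0 where "n0 = max (Suc k) (nat \<lceil>2 * ((1 + u) * Q + q) / (v - u)\<rceil> + 1)"
    obtain n where n: "n0 \<le> n" "pow_dist b \<xi> n \<le> real b powr (- v * real n + q)"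
      using inf unfolding infinite_nat_iff_unbounded_le by blast
    obtain i where i: "1 \<le> i" "n \<le> a i" "real (a i) \<le> (1 + \<epsilon>) * real n + Q" using Q by blast
    have "2 * ((1 + u) * Q + q) / (v - u) < real n" using n(1) unfolding n0_def by linarith
    then have n': "(1 + u) * Q + q < (v - u) / 2 * real n" using u by (simp add: field_simps)
    have "(1 + u) * real (a i) \<le> (1 + u) * ((1 + \<epsilon>) * real n + Q)"
      using i u by (intro mult_left_mono) auto
    also have "\<dots> = (1 + (u + v) / 2) * real n + (1 + u) * Q"
      using \<epsilon>(2) by (simp add: distrib_left flip: mult.assoc)
    finally have "real (a i) - real n + (- v * real n + q) < - u * real (a i)"
      using n' by (simp add: field_simps)
    then have "real b powr (real (a i) - real n) * real b powr (- v * real n + q)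
        < real b powr (- u * real (a i))"
      by (simp only: powr_add[symmetric] powr_less')
    moreover have "pow_dist b \<xi> (a i)
        \<le> real b powr (real (a i) - real n) * real b powr (- v * real n + q)"
      using pow_dist_le[OF i(2), of \<xi>] n(2) by (meson mult_left_mono order_trans powr_ge_zero)
    ultimately have "i \<in> ?S" using i by simp
    then have "a i \<le> k" by (rule k)
    then show False using i n unfolding n0_def by simp
  qed
  then have "ereal u \<le> v_exp b a \<xi>" unfolding v_exp_eq using u by (intro Sup_upper) auto
  then have "ereal (v - e) \<le> v_exp b a \<xi>" using u by (meson ereal_less_eq(3) order_trans)
  then show "ereal v \<le> v_exp b a \<xi> + ereal e" by (cases "v_exp b a \<xi>") auto
qed

text \<open>Given \<open>a I\<close>, the hypothesis is used at a slightly smaller N, so that the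
  term of A following the approximating position n \<le> N is still at most
  \<open>a I\<close>.\<close>

lemma v_hat_exp_geI:
  assumes w: "0 < w"
    and ub: "\<And>N. \<exists>n\<le>N. pow_dist b \<xi> n \<le> real b powr (- w * real N + q)"
  shows "ereal w \<le> v_hat_exp b a \<xi>"
proof (rule ereal_le_epsilon2)
  fix e :: real assume e: "0 < e"
  define u where "u = max 0 (w - e)"
  have u: "0 \<le> u" "u < w" "w - e \<le> u" using w e by (auto simp: u_def)
  define \<epsilon> where "\<epsilon> = (w - u) / (2 * (1 + u))"
  have \<epsilon>: "0 < \<epsilon>" "w - \<epsilon> = u * (1 + \<epsilon>) + (w - u) / 2"
    using u by (simp_all add: \<epsilon>_def field_simps)
  obtain Q where Q: "0 \<le> Q"
    "\<And>n. \<exists>i\<ge>1. 1 \<le> i \<and> n \<le> a i \<and> real (a i) \<le> (1 + \<epsilon>) * real n + Q"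
    using next_term[OF \<epsilon>(1), of 1] by blast
  \<comment> \<open>The exponent that remains relative to \<open>a I\<close> after losing \<epsilon>
    N in moving to a term of A and the factor 1 + \<epsilon> between N and
    \<open>a I\<close>.\<close>
  define c where "c = (w - \<epsilon>) / (1 + \<epsilon>)"
  have c: "u < c" "c * (1 + \<epsilon>) = w - \<epsilon>"
    using \<epsilon> u by (simp_all add: c_def pos_less_divide_eq)
  define K where "K = c * (Q + 1 + \<epsilon>) + q + Q"
  have "\<forall>\<^sub>F I in sequentially. \<exists>i. 1 \<le> i \<and> i \<le> I \<and>
      pow_dist b \<xi> (a i) < real b powr (- u * real (a I))"
    unfolding eventually_sequentially
  proof (rule exI[of _ "nat \<lceil>K / (c - u)\<rceil> + nat \<lceil>Q\<rceil> + 1"], intro allI impI)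
    fix I assume "nat \<lceil>K / (c - u)\<rceil> + nat \<lceil>Q\<rceil> + 1 \<le> I"
    then have I: "1 \<le> I" "Q \<le> real (a I)" "K / (c - u) < real (a I)"
      using a_ge[of I] by linarith+
    define N where "N = nat \<lfloor>(real (a I) - Q) / (1 + \<epsilon>)\<rfloor>"
    have "0 \<le> (real (a I) - Q) / (1 + \<epsilon>)" using I \<epsilon> by simp
    then have "real N \<le> (real (a I) - Q) / (1 + \<epsilon>)" "(real (a I) - Q) / (1 + \<epsilon>) < real N + 1"
      unfolding N_def by linarith+
    then have N: "(1 + \<epsilon>) * real N + Q \<le> real (a I)" "real (a I) < (1 + \<epsilon>) * (real N + 1) + Q"
      using \<epsilon> by (simp_all add: field_simps)
    obtain n where n: "n \<le> N" "pow_dist b \<xi> n \<le> real b powr (- w * real N + q)"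
      using ub by blast
    obtain i where i: "1 \<le> i" "n \<le> a i" "real (a i) \<le> (1 + \<epsilon>) * real n + Q" using Q by blast
    have "\<epsilon> * real n \<le> \<epsilon> * real N" using n \<epsilon> by simp
    then have gap: "real (a i) - real n \<le> \<epsilon> * real N + Q" using i(3) by (simp add: algebra_simps)
    have "real (a i) \<le> real (a I)" using gap N n by (simp add: algebra_simps)
    then have "i \<le> I" using a_le_iff[of i I] i I by simp
    have "c * real (a I) \<le> c * ((1 + \<epsilon>) * (real N + 1) + Q)"
      using N(2) c u by (intro mult_left_mono) auto
    also have "\<dots> = (w - \<epsilon>) * real N + (c * (Q + 1 + \<epsilon>))"
      by (simp add: algebra_simps flip: c(2))
    finally have "c * real (a I) \<le> (w - \<epsilon>) * real N + (c * (Q + 1 + \<epsilon>))" .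
    moreover have "K < (c - u) * real (a I)" using I(3) c by (simp add: field_simps)
    ultimately have "real (a i) - real n + (- w * real N + q) < - u * real (a I)"
      using gap unfolding K_def by (simp add: algebra_simps)
    then have "real b powr (real (a i) - real n) * real b powr (- w * real N + q)
        < real b powr (- u * real (a I))"
      by (simp only: powr_add[symmetric] powr_less')
    moreover have "pow_dist b \<xi> (a i)
        \<le> real b powr (real (a i) - real n) * real b powr (- w * real N + q)"
      using pow_dist_le[OF i(2), of \<xi>] n(2) by (meson mult_left_mono order_trans powr_ge_zero)
    ultimately show "\<exists>i. 1 \<le> i \<and> i \<le> I \<and> pow_dist b \<xi> (a i) < real b powr (- u * real (a I))"
      using i \<open>i \<le> I\<close> by (intro exI[of _ i]) simp
  qed
  then have "ereal u \<le> v_hat_exp b a \<xi>" unfolding v_hat_exp_eq using u by (intro Sup_upper) auto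
  then have "ereal (w - e) \<le> v_hat_exp b a \<xi>" using u by (meson ereal_less_eq(3) order_trans)
  then show "ereal w \<le> v_hat_exp b a \<xi> + ereal e" by (cases "v_hat_exp b a \<xi>") auto
qed

text \<open>At a bad N, every term of A up to N inherits the lower bound. An exponent u > w would
  contradict it at the last such term, which is nearly N; w' separates the loss in position from the
  additive constants.\<close>

lemma v_hat_exp_leI:
  assumes w: "0 < w"
    and inf: "infinite {N. \<forall>n\<le>N. real b powr (- w * real N - q) \<le> pow_dist b \<xi> n}"
  shows "v_hat_exp b a \<xi> \<le> ereal w"
  unfolding v_hat_exp_eq
proof (rule Sup_least, clarify)
  fix u assume ev: "\<forall>\<^sub>F I in sequentially. \<exists>i. 1 \<le> i \<and> i \<le> I \<and>
      pow_dist b \<xi> (a i) < real b powr (- u * real (a I))"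
  show "ereal u \<le> ereal w"
  proof (rule ccontr)
    assume "\<not> ereal u \<le> ereal w"
    then have uw: "w < u" by simp
    obtain i0 where i0: "\<And>I. i0 \<le> I \<Longrightarrow>
        \<exists>i. 1 \<le> i \<and> i \<le> I \<and> pow_dist b \<xi> (a i) < real b powr (- u * real (a I))"
      using ev unfolding eventually_sequentially by blast
    define w' where "w' = (u + w) / 2"
    have w': "w < w'" "w' < u" using uw by (auto simp: w'_def)
    define \<epsilon> where "\<epsilon> = u / w' - 1"
    have \<epsilon>: "0 < \<epsilon>" "w' * (1 + \<epsilon>) = u" using w w' by (simp_all add: \<epsilon>_def field_simps)
    obtain Q where Q: "0 \<le> Q"
      "\<And>N. Q \<le> real N \<Longrightarrow> \<exists>i\<ge>i0. 1 \<le> i \<and> a i \<le> N \<and> real N \<le> (1 + \<epsilon>) * real (a i) + Q"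
      using previous_term[OF \<epsilon>(1)] by blast
    obtain N where N: "nat \<lceil>Q\<rceil> + nat \<lceil>(w' * Q + q) / (w' - w)\<rceil> + 1 \<le> N"
      "\<And>n. n \<le> N \<Longrightarrow> real b powr (- w * real N - q) \<le> pow_dist b \<xi> n"
      using inf unfolding infinite_nat_iff_unbounded_le by blast
    from N(1) have "Q \<le> real N" "(w' * Q + q) / (w' - w) < real N" by linarith+
    then obtain I where I: "i0 \<le> I" "1 \<le> I" "a I \<le> N" "real N \<le> (1 + \<epsilon>) * real (a I) + Q"
      using Q by blast
    obtain i where i: "1 \<le> i" "i \<le> I" "pow_dist b \<xi> (a i) < real b powr (- u * real (a I))"
      using i0 I by blast
    have "a i \<le> N" using a_le_iff[of i I] i I by auto
    then have "real b powr (- w * real N - q) < real b powr (- u * real (a I))"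
      using N(2) i(3) by (meson order.strict_trans1)
    then have "u * real (a I) < w * real N + q" by (simp add: powr_less')
    moreover have "w' * real N \<le> w' * ((1 + \<epsilon>) * real (a I) + Q)"
      using I w w' by (intro mult_left_mono) auto
    then have "w' * real N \<le> u * real (a I) + w' * Q"
      using \<epsilon>(2) by (simp add: distrib_left flip: mult.assoc)
    moreover have "w' * Q + q < (w' - w) * real N"
      using \<open>(w' * Q + q) / (w' - w) < real N\<close> w' by (simp add: field_simps)
    ultimately show False by (simp add: algebra_simps)
  qed
qed

end

section \<open>Upper bound\<close>

text \<open>Below the threshold 1 / (2b), multiplication by b scales the distance exactly, so that a
  run present at r - 1 merely continues at r. Position 0 has no predecessor and always counts as a
  start.\<close>

definition run_start :: "nat \<Rightarrow> real \<Rightarrow> nat \<Rightarrow> bool" where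
  "run_start b \<xi> r \<longleftrightarrow> r = 0 \<or> 1 / (2 * real b) \<le> pow_dist b \<xi> (r - 1)"

text \<open>The least position with distance below x is a start: otherwise the distance one position
  earlier would be smaller still.\<close>

lemma run_start_exists:
  assumes "pow_dist b \<xi> n < x"
  obtains r where "r \<le> n" "run_start b \<xi> r" "pow_dist b \<xi> r < x"
proof -
  define r where "r = (LEAST r. pow_dist b \<xi> r < x)"
  have r: "pow_dist b \<xi> r < x" "r \<le> n"
    unfolding r_def using assms by (auto intro: LeastI Least_le)
  have "run_start b \<xi> r"
  proof (rule ccontr)
    assume "\<not> run_start b \<xi> r"
    then obtain m where m: "r = Suc m" and lt: "pow_dist b \<xi> m < 1 / (2 * real b)"
      by (cases r) (auto simp: run_start_def)
    have "b \<noteq> 0" using lt pow_dist_nonneg[of b \<xi> m] by (intro notI) simp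
    then have "pow_dist b \<xi> r = real b * pow_dist b \<xi> m"
      using dist_nearest_int_mult_eq[of b "real b ^ m * \<xi>"] lt
      by (simp add: m pow_dist_def field_simps)
    moreover have "1 * pow_dist b \<xi> m \<le> real b * pow_dist b \<xi> m"
      using \<open>b \<noteq> 0\<close> by (intro mult_right_mono pow_dist_nonneg) simp
    ultimately have "pow_dist b \<xi> m < x" using r(1) by simp
    then have "r \<le> m" unfolding r_def by (rule Least_le)
    then show False using m by simp
  qed
  then show ?thesis using that r by blast
qed

section \<open>Counting the prefixes at which a run starts\<close>

lemma card_int_near:
  fixes c :: int and R :: real
  assumes "0 \<le> R"
  shows "finite {m::int. \<bar>of_int m - of_int c :: real\<bar> \<le> R}"
    and "real (card {m::int. \<bar>of_int m - of_int c :: real\<bar> \<le> R}) \<le> 2 * R + 1"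
proof -
  have sub: "{m::int. \<bar>of_int m - of_int c :: real\<bar> \<le> R} \<subseteq> {c - \<lfloor>R\<rfloor>..c + \<lfloor>R\<rfloor>}"
  proof
    fix m :: int assume "m \<in> {m. \<bar>of_int m - of_int c :: real\<bar> \<le> R}"
    then have "of_int \<bar>m - c\<bar> \<le> R" by simp
    then have "\<bar>m - c\<bar> \<le> \<lfloor>R\<rfloor>" by (simp add: le_floor_iff)
    then show "m \<in> {c - \<lfloor>R\<rfloor>..c + \<lfloor>R\<rfloor>}" by auto
  qed
  show "finite {m::int. \<bar>of_int m - of_int c :: real\<bar> \<le> R}"
    using sub finite_subset by blast
  have "card {m::int. \<bar>of_int m - of_int c :: real\<bar> \<le> R} \<le> card {c - \<lfloor>R\<rfloor>..c + \<lfloor>R\<rfloor>}"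
    by (intro card_mono sub) simp
  also have "\<dots> = nat (2 * \<lfloor>R\<rfloor> + 1)" by simp
  finally have "real (card {m::int. \<bar>of_int m - of_int c :: real\<bar> \<le> R}) \<le> real (nat (2 * \<lfloor>R\<rfloor> + 1))"
    by simp
  also have "\<dots> \<le> 2 * R + 1" using assms by (simp add: of_nat_nat)
  finally show "real (card {m::int. \<bar>of_int m - of_int c :: real\<bar> \<le> R}) \<le> 2 * R + 1" .
qed

text \<open>One piece of the countable decomposition: w, v and u stand for the perturbed exponents w
  - \<epsilon>, v + \<epsilon> and v - \<epsilon>, and the single \<open>q\<close> bounds the points
  and all additive errors in the exponents.\<close>

locale uniform_approx =
  fixes b :: nat and w v u q :: real and E :: "real set"
  assumes b: "2 \<le> b"
    and wv: "0 < w" "w < v" and u: "0 < u" and q: "0 \<le> q"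
    and bounded_E: "\<And>\<xi>. \<xi> \<in> E \<Longrightarrow> \<bar>\<xi>\<bar> \<le> q"
    and lower: "\<And>\<xi> n. \<xi> \<in> E \<Longrightarrow> real b powr (- v * real n - q) \<le> pow_dist b \<xi> n"
    and uniform: "\<And>\<xi> N. \<xi> \<in> E \<Longrightarrow> \<exists>n\<le>N. pow_dist b \<xi> n < real b powr (- w * real N + q)"
    and often: "\<And>\<xi>. \<xi> \<in> E \<Longrightarrow> infinite {n. pow_dist b \<xi> n < real b powr (- u * real n)}"
begin

text \<open>A prefix is encoded by rounding instead of truncating, so that b^N \<xi> lies within
  \<open>pow_dist b \<xi> N\<close> of it whether the run consists of digits 0 or b - 1.\<close>

definition S :: "nat \<Rightarrow> int set" where
  "S N = (\<lambda>\<xi>. round (real b ^ N * \<xi>)) ` {\<xi> \<in> E. run_start b \<xi> N}"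

lemma b_powr_mono: "x \<le> y \<Longrightarrow> real b powr x \<le> real b powr y"
  using b by (intro powr_mono) auto

lemma b_powr_less: "real b powr x < real b powr y \<longleftrightarrow> x < y"
  using b by (intro powr_less_cancel_iff) auto

lemma card_S_trivial: "finite (S N)" "real (card (S N)) \<le> (2 * q + 3) * real b powr real N"
proof -
  define R where "R = q * real b ^ N + 1 / 2"
  have R: "0 \<le> R" using q by (simp add: R_def)
  have "S N \<subseteq> {m::int. \<bar>of_int m - of_int 0 :: real\<bar> \<le> R}"
  proof
    fix m assume "m \<in> S N"
    then obtain \<xi> where \<xi>: "\<xi> \<in> E" "m = round (real b ^ N * \<xi>)" unfolding S_def by blast
    have "\<bar>of_int m - real b ^ N * \<xi>\<bar> \<le> 1 / 2" unfolding \<xi>(2) by (rule of_int_round_abs_le)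
    moreover have "\<bar>real b ^ N * \<xi>\<bar> \<le> q * real b ^ N"
      using bounded_E[OF \<xi>(1)] by (simp add: abs_mult mult.commute mult_right_mono)
    ultimately have "\<bar>of_int m :: real\<bar> \<le> R" unfolding R_def by linarith
    then show "m \<in> {m::int. \<bar>of_int m - of_int 0 :: real\<bar> \<le> R}" by simp
  qed
  then show "finite (S N)"
    and "real (card (S N)) \<le> (2 * q + 3) * real b powr real N"
  proof -
    assume sub: "S N \<subseteq> {m::int. \<bar>of_int m - of_int 0 :: real\<bar> \<le> R}"
    show "finite (S N)" using finite_subset[OF sub card_int_near(1)[OF R]] .
    have "real (card (S N)) \<le> real (card {m::int. \<bar>of_int m - of_int 0 :: real\<bar> \<le> R})"
      using card_mono[OF card_int_near(1)[OF R] sub] by simp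
    also have "\<dots> \<le> 2 * R + 1" by (rule card_int_near(2)[OF R])
    also have "\<dots> \<le> (2 * q + 3) * real b ^ N"
    proof -
      have "1 \<le> real b ^ N" using b by (intro one_le_power) simp
      then show ?thesis by (simp add: R_def algebra_simps)
    qed
    finally show "real (card (S N)) \<le> (2 * q + 3) * real b powr real N"
      using b by (simp add: powr_realpow)
  qed
qed

text \<open>
  A run of extreme digits starting at \<open>r\<close> that is long compared with \<open>N\<close> ends before the
  next start \<open>N + 1\<close>, so it fixes the digits on a segment of length about \<open>w N\<close>.
\<close>

lemma previous_start:
  assumes "\<xi> \<in> E" "run_start b \<xi> (Suc N)"
  obtains r where "r \<le> N" "run_start b \<xi> r" "w * real N < v * real r + 2 * q"
    "0 < real N - real r - w * real N + q + 2"
    "\<bar>of_int (round (real b ^ Suc N * \<xi>)) - of_int (int (b ^ (Suc N - r)) * round (real b ^ r * \<xi>))\<bar>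
       \<le> real b powr (real N - real r - w * real N + q + 1) + 1 / 2"
proof -
  obtain n where n: "n \<le> N" "pow_dist b \<xi> n < real b powr (- w * real N + q)"
    using uniform[OF assms(1)] by blast
  obtain r where "r \<le> n" and r: "run_start b \<xi> r" "pow_dist b \<xi> r < real b powr (- w * real N + q)"
    using run_start_exists[OF n(2)] by blast
  with n have r: "r \<le> N" "run_start b \<xi> r" "pow_dist b \<xi> r < real b powr (- w * real N + q)"
    by auto
  \<comment> \<open>The run at r cannot be longer than about v r, yet it has length at least about w
    N; hence r is at least about (w / v) N.\<close>
  have "real b powr (- v * real r - q) < real b powr (- w * real N + q)"
    using lower[OF assms(1)] r(3) by (rule order.strict_trans1)
  then have 1: "w * real N < v * real r + 2 * q" by (simp add: b_powr_less)
  \<comment> \<open>A start at \<open>Suc N\<close> keeps the distance at N above 1 / (2b), hence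
    above b^(-2). The run from r must therefore be exhausted by N, up to a bounded number of
    digits.\<close>
  have "real b powr (-2) \<le> 1 / (2 * real b)"
  proof -
    have "real b powr (-2) = 1 / real b ^ 2" using b by (simp add: powr_minus_divide)
    also have "\<dots> \<le> 1 / (2 * real b)"
      using b by (intro divide_left_mono) (auto simp: power2_eq_square)
    finally show ?thesis .
  qed
  also have "\<dots> \<le> pow_dist b \<xi> N" using assms(2) by (simp add: run_start_def)
  also have "\<dots> \<le> real b powr (real N - real r) * pow_dist b \<xi> r"
    using b r(1) by (rule pow_dist_le_powr)
  also have "\<dots> < real b powr (real N - real r) * real b powr (- w * real N + q)"
    using r(3) b by (intro mult_strict_left_mono) auto
  finally have 2: "0 < real N - real r - w * real N + q + 2"
    by (simp add: b_powr_less algebra_simps flip: powr_add)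
  have "of_int (int (b ^ (Suc N - r)) * round (real b ^ r * \<xi>)) - real b ^ Suc N * \<xi>
      = real b ^ (Suc N - r) * (of_int (round (real b ^ r * \<xi>)) - real b ^ r * \<xi>)"
    using r(1) by (simp add: right_diff_distrib flip: power_add mult.assoc)
  then have "\<bar>of_int (int (b ^ (Suc N - r)) * round (real b ^ r * \<xi>)) - real b ^ Suc N * \<xi>\<bar>
      = real b ^ (Suc N - r) * pow_dist b \<xi> r"
    by (simp add: abs_mult pow_dist_def dist_nearest_int_def abs_minus_commute)
  also have "\<dots> = real b powr (real N + 1 - real r) * pow_dist b \<xi> r"
    using r(1) b by (simp add: of_nat_diff add.commute flip: powr_realpow)
  also have "\<dots> \<le> real b powr (real N + 1 - real r) * real b powr (- w * real N + q)"
    using r(3) by (intro mult_left_mono) auto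
  also have "\<dots> = real b powr (real N - real r - w * real N + q + 1)"
    by (simp add: algebra_simps flip: powr_add)
  finally have 3: "\<bar>of_int (round (real b ^ Suc N * \<xi>)) -
      of_int (int (b ^ (Suc N - r)) * round (real b ^ r * \<xi>))\<bar>
       \<le> real b powr (real N - real r - w * real N + q + 1) + 1 / 2"
    using of_int_round_abs_le[of "real b ^ Suc N * \<xi>"] by linarith
  show ?thesis using that[OF r(1,2) 1 2 3] .
qed

text \<open>Once r and its prefix are fixed, the run determines the prefix of length
  \<open>Suc N\<close> up to an integer error of order b^(N - r - w N); the sum counts the possible
  errors.\<close>

lemma card_S_Suc:
  "real (card (S (Suc N))) \<le> (\<Sum>r\<in>{r. r \<le> N \<and> w * real N < v * real r + 2 * q}.
     real (card (S r)) * (6 * real b powr (q + 2) * real b powr (real N - real r - w * real N)))"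
proof -
  let ?A = "{r. r \<le> N \<and> w * real N < v * real r + 2 * q}"
  \<comment> \<open>Positivity of this exponent lets its power of b, which is then at least 1,
    absorb the rounding terms in \<open>card_int_near\<close>.\<close>
  define A where "A = {r \<in> ?A. 0 < real N - real r - w * real N + q + 2}"
  define R where "R = (\<lambda>r. real b powr (real N - real r - w * real N + q + 1) + 1 / 2)"
  define B where "B = (\<lambda>r c. {m::int. \<bar>of_int m - of_int (int (b ^ (Suc N - r)) * c) :: real\<bar> \<le> R r})"
  have R0: "0 \<le> R r" for r by (simp add: R_def)
  have fin: "finite ?A" "finite A" by (auto simp: A_def)
  have cardB: "real (card (B r c)) \<le> 6 * real b powr (q + 2) * real b powr (real N - real r - w * real N)"
    if "r \<in> A" for r c
  proof -
    define x where "x = real N - real r - w * real N + q + 2"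
    have x: "1 \<le> real b powr x"
      using that b b_powr_mono[of 0 x] by (simp add: A_def x_def)
    have "real b powr (x - 1) \<le> real b powr x" by (intro b_powr_mono) simp
    then have "R r \<le> real b powr x + 1 / 2"
      by (simp add: R_def x_def algebra_simps)
    then have "real (card (B r c)) \<le> 2 * (real b powr x + 1 / 2) + 1"
      unfolding B_def by (intro order_trans[OF card_int_near(2)[OF R0]]) simp
    also have "\<dots> \<le> 6 * real b powr x" using x by simp
    also have "\<dots> = 6 * real b powr (q + 2) * real b powr (real N - real r - w * real N)"
      by (simp add: x_def algebra_simps flip: powr_add)
    finally show ?thesis .
  qed
  have sub: "S (Suc N) \<subseteq> (\<Union>r\<in>A. \<Union>c\<in>S r. B r c)"
  proof
    fix m assume "m \<in> S (Suc N)"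
    then obtain \<xi> where \<xi>: "\<xi> \<in> E" "run_start b \<xi> (Suc N)" "m = round (real b ^ Suc N * \<xi>)"
      unfolding S_def by blast
    obtain r where r: "r \<le> N" "run_start b \<xi> r" "w * real N < v * real r + 2 * q"
      "0 < real N - real r - w * real N + q + 2"
      "\<bar>of_int m - of_int (int (b ^ (Suc N - r)) * round (real b ^ r * \<xi>)) :: real\<bar> \<le> R r"
      unfolding R_def \<xi>(3) using previous_start[OF \<xi>(1,2)] by blast
    have "m \<in> B r (round (real b ^ r * \<xi>))" unfolding B_def using r(5) by blast
    moreover have "round (real b ^ r * \<xi>) \<in> S r" unfolding S_def using \<xi> r by blast
    moreover have "r \<in> A" using r by (simp add: A_def)
    ultimately show "m \<in> (\<Union>r\<in>A. \<Union>c\<in>S r. B r c)" by blast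
  qed
  have "card (S (Suc N)) \<le> card (\<Union>r\<in>A. \<Union>c\<in>S r. B r c)"
    using fin card_S_trivial(1) card_int_near(1)[OF R0]
    by (intro card_mono sub) (auto simp: B_def simp del: of_int_mult)
  also have "\<dots> \<le> (\<Sum>r\<in>A. card (\<Union>c\<in>S r. B r c))" by (intro card_UN_le fin)
  also have "\<dots> \<le> (\<Sum>r\<in>A. \<Sum>c\<in>S r. card (B r c))"
    by (intro sum_mono card_UN_le card_S_trivial)
  finally have "real (card (S (Suc N))) \<le> real (\<Sum>r\<in>A. \<Sum>c\<in>S r. card (B r c))"
    using of_nat_le_iff by blast
  also have "\<dots> = (\<Sum>r\<in>A. \<Sum>c\<in>S r. real (card (B r c)))" by simp
  also have "\<dots> \<le> (\<Sum>r\<in>A. \<Sum>c\<in>S r.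
      6 * real b powr (q + 2) * real b powr (real N - real r - w * real N))"
    by (intro sum_mono cardB)
  also have "\<dots> = (\<Sum>r\<in>A. real (card (S r)) *
      (6 * real b powr (q + 2) * real b powr (real N - real r - w * real N)))"
    by simp
  also have "\<dots> \<le> (\<Sum>r\<in>?A. real (card (S r)) *
      (6 * real b powr (q + 2) * real b powr (real N - real r - w * real N)))"
    using fin by (intro sum_mono2) (auto simp: A_def)
  finally show ?thesis .
qed

text \<open>Strong induction on N: each summand of the recursion falls short of the target by
  b^(-\<sigma> N), which outweighs both the number N + 1 of summands and the constant
  \<open>C\<close> once N is large.\<close>

lemma card_S_bound:
  assumes \<gamma>: "\<gamma> < 1" "1 - w * v / (v - w) < \<gamma>"
  obtains K where "0 \<le> K" "\<And>N. real (card (S N)) \<le> K * real b powr (\<gamma> * real N)"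
proof -
  \<comment> \<open>The gap between \<gamma> and the normalized exponent of the worst summand, at r
    = (w / v) N. It is positive exactly when \<gamma> exceeds 1 - w v / (v - w).\<close>
  define \<sigma> where "\<sigma> = \<gamma> - (1 - w) + (1 - \<gamma>) * w / v"
  have v: "0 < v" using wv by simp
  have "(1 - \<gamma>) * (v - w) < w * v" using \<gamma>(2) wv by (simp add: field_simps)
  then have \<sigma>: "0 < \<sigma>" using v by (simp add: \<sigma>_def field_simps)
  \<comment> \<open>The last exponent collects the shift 2q / v in the lower bound for r and the
    step from N to M = N + 1.\<close>
  define C where "C = 6 * real b powr (q + 2) * real b powr ((1 - \<gamma>) * (2 * q) / v - \<gamma>)"
  have lt: "norm (real b powr (- \<sigma>)) < 1"
    using b \<sigma> b_powr_less[of "- \<sigma>" 0] by simp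
  have "(\<lambda>N. C * (real N * (real b powr (- \<sigma>)) ^ N) + C * (real b powr (- \<sigma>)) ^ N)
      \<longlonglongrightarrow> C * 0 + C * 0"
    by (intro tendsto_add tendsto_mult[OF tendsto_const] powser_times_n_limit_0[OF lt]
        LIMSEQ_power_zero[OF lt])
  then have "\<forall>\<^sub>F N in sequentially.
      C * (real N * (real b powr (- \<sigma>)) ^ N) + C * (real b powr (- \<sigma>)) ^ N < 1"
    by (rule order_tendstoD) simp
  then obtain N1 where N1: "\<And>N. N1 \<le> N \<Longrightarrow>
      C * (real N * (real b powr (- \<sigma>)) ^ N) + C * (real b powr (- \<sigma>)) ^ N < 1"
    unfolding eventually_sequentially by blast
  have step: "(real N + 1) * C \<le> real b powr (\<sigma> * real N)" if "N1 \<le> N" for N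
  proof -
    have eq: "(real b powr (- \<sigma>)) ^ N * real b powr (\<sigma> * real N) = 1"
      using b by (simp add: powr_power flip: powr_add)
    have "(real N + 1) * C * (real b powr (- \<sigma>)) ^ N \<le> 1"
      using N1[OF that] by (simp add: algebra_simps)
    then have "(real N + 1) * C * (real b powr (- \<sigma>)) ^ N * real b powr (\<sigma> * real N)
        \<le> 1 * real b powr (\<sigma> * real N)"
      by (intro mult_right_mono) auto
    then show ?thesis using eq by (simp add: mult.assoc)
  qed
  \<comment> \<open>Chosen so that the trivial count b^M already proves the claim up to
    \<open>N1\<close>.\<close>
  define K where "K = (2 * q + 3) * real b powr ((1 - \<gamma>) * real N1)"
  have K0: "0 \<le> K" using q by (simp add: K_def)
  have "real (card (S N)) \<le> K * real b powr (\<gamma> * real N)" for N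
  proof (induction N rule: less_induct)
    case (less M)
    show ?case
    proof (cases "M \<le> N1")
      case True
      have "(1 - \<gamma>) * real M \<le> (1 - \<gamma>) * real N1" using True \<gamma> by (intro mult_left_mono) auto
      then have "real b powr real M \<le> real b powr ((1 - \<gamma>) * real N1 + \<gamma> * real M)"
        by (intro b_powr_mono) (simp add: algebra_simps)
      then have "(2 * q + 3) * real b powr real M
          \<le> (2 * q + 3) * real b powr ((1 - \<gamma>) * real N1 + \<gamma> * real M)"
        using q by (intro mult_left_mono) auto
      then show ?thesis using card_S_trivial(2)[of M] by (simp add: K_def powr_add mult.assoc)
    next
      case False
      then obtain N where N: "M = Suc N" "N1 \<le> N" by (cases M) auto
      let ?A = "{r. r \<le> N \<and> w * real N < v * real r + 2 * q}"
      have term_le: "real (card (S r)) * (6 * real b powr (q + 2) * real b powr (real N - real r - w * real N))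
          \<le> K * C * real b powr (\<gamma> * real M - \<sigma> * real N)" if "r \<in> ?A" for r
      proof -
        have "real (card (S r)) * (6 * real b powr (q + 2) * real b powr (real N - real r - w * real N))
          \<le> K * real b powr (\<gamma> * real r) * (6 * real b powr (q + 2) * real b powr (real N - real r - w * real N))"
          using that N by (intro mult_right_mono less.IH) auto
        also have "\<dots> = K * (6 * real b powr (q + 2) *
            real b powr ((1 - w) * real N - (1 - \<gamma>) * real r))"
          by (simp add: algebra_simps flip: powr_add)
        also have "\<dots> \<le> K * (6 * real b powr (q + 2) *
            real b powr ((1 - w) * real N - (1 - \<gamma>) * ((w * real N - 2 * q) / v)))"
        proof (intro mult_left_mono b_powr_mono diff_left_mono)
          show "(w * real N - 2 * q) / v \<le> real r"
            using that v by (simp add: field_simps)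
        qed (use \<gamma> K0 in auto)
        also have "(1 - w) * real N - (1 - \<gamma>) * ((w * real N - 2 * q) / v)
            = ((1 - \<gamma>) * (2 * q) / v - \<gamma>) + (\<gamma> * real M - \<sigma> * real N)"
          using v by (simp add: N \<sigma>_def field_simps)
        finally show ?thesis by (simp only: C_def powr_add mult.assoc)
      qed
      have "real (card (S M)) \<le> (\<Sum>r\<in>?A. K * C * real b powr (\<gamma> * real M - \<sigma> * real N))"
        unfolding N(1) by (intro order_trans[OF card_S_Suc] sum_mono) (use term_le N in simp)
      also have "\<dots> \<le> (\<Sum>r\<in>{..N}. K * C * real b powr (\<gamma> * real M - \<sigma> * real N))"
        using K0 by (intro sum_mono2) (auto simp: C_def)
      also have "\<dots> = K * real b powr (\<gamma> * real M - \<sigma> * real N) * ((real N + 1) * C)"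
        by simp
      also have "\<dots> \<le> K * real b powr (\<gamma> * real M - \<sigma> * real N) * real b powr (\<sigma> * real N)"
        using K0 by (intro mult_left_mono step N) auto
      also have "\<dots> = K * real b powr (\<gamma> * real M)" by (simp add: mult.assoc flip: powr_add)
      finally show ?thesis .
    qed
  qed
  then show ?thesis using that K0 by blast
qed

text \<open>Sliding an approximating position n back to the start r \<le> n of its run keeps the
  smallness, and the lower bound at r forces r to infinity with n.\<close>

lemma infinite_run_starts:
  assumes "\<xi> \<in> E"
  shows "infinite {r. run_start b \<xi> r \<and> pow_dist b \<xi> r < real b powr (- u * real r)}"
  unfolding infinite_nat_iff_unbounded
proof
  fix m
  obtain n where n: "nat \<lceil>(v * real m + q) / u\<rceil> + 1 \<le> n" "pow_dist b \<xi> n < real b powr (- u * real n)"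
    using often[OF assms] unfolding infinite_nat_iff_unbounded_le by blast
  have "(v * real m + q) / u < real n" using n(1) by linarith
  then have n': "v * real m + q < u * real n" using u by (simp add: field_simps)
  obtain r where r: "r \<le> n" "run_start b \<xi> r" "pow_dist b \<xi> r < real b powr (- u * real n)"
    using run_start_exists[OF n(2)] by blast
  have "real b powr (- v * real r - q) < real b powr (- u * real n)"
    using lower[OF assms] r(3) by (rule order.strict_trans1)
  then have "v * real m < v * real r" using n' by (simp add: b_powr_less)
  then have "m < r" using wv by simp
  moreover have "real b powr (- u * real n) \<le> real b powr (- u * real r)"
    using r(1) u by (intro b_powr_mono) simp
  ultimately show "\<exists>r>m. r \<in> {r. run_start b \<xi> r \<and> pow_dist b \<xi> r < real b powr (- u * real r)}"
    using r by (intro exI[of _ r]) simp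
qed

text \<open>At level r there are at most K b^(\<gamma> r) intervals of length 2 b^(-(1 + u) r), and
  \<gamma> < s (1 + u) makes the sum of their s-th powers converge.\<close>

theorem hausdorff_measure_null:
  assumes s: "0 < s" "1 - w * v / (v - w) < s * (1 + u)"
  shows "hausdorff_measure s E = 0"
proof -
  have "1 - w * v / (v - w) < min 1 (s * (1 + u))" using s wv by simp
  then obtain \<gamma> where \<gamma>: "1 - w * v / (v - w) < \<gamma>" "\<gamma> < 1" "\<gamma> < s * (1 + u)"
    using dense by (metis min_less_iff_conj)
  then obtain K where K: "0 \<le> K" "\<And>N. real (card (S N)) \<le> K * real b powr (\<gamma> * real N)"
    using card_S_bound by blast
  \<comment> \<open>A run longer than u r from position r puts \<xi> within b^(-(1 + u) r) of its
    rounded prefix divided by b^r.\<close>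
  define \<rho> where "\<rho> = (\<lambda>r. 2 * real b powr (- (1 + u) * real r))"
  define I where "I = (\<lambda>r (c::int). {of_int c / real b ^ r - \<rho> r / 2 .. of_int c / real b ^ r + \<rho> r / 2})"
  have \<rho>_power: "\<rho> r = 2 * (real b powr (- (1 + u))) ^ r" for r
    using b by (simp add: \<rho>_def powr_power mult.commute)
  show ?thesis
  proof (rule hausdorff_measure_limsup_null[OF s(1), where S=S and I=I and \<rho>=\<rho>])
    show "finite (S r)" for r by (rule card_S_trivial)
    show "bounded (I r c)" for r c unfolding I_def by (rule bounded_closed_interval)
    show "diameter (I r c) \<le> \<rho> r" for r c by (simp add: I_def \<rho>_def)
    have "norm (real b powr (- (1 + u))) < 1" using b u b_powr_less[of "- (1 + u)" 0] by simp
    then show "\<rho> \<longlonglongrightarrow> 0"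
      unfolding \<rho>_power[abs_def] by (intro tendsto_mult_right_zero LIMSEQ_power_zero)
    show "summable (\<lambda>r. real (card (S r)) * \<rho> r powr s)"
    proof (rule summable_comparison_test')
      have "real b powr (\<gamma> - (1 + u) * s) < 1"
        using \<gamma>(3) b b_powr_less[of "\<gamma> - (1 + u) * s" 0] by (simp add: mult.commute)
      then show "summable (\<lambda>r. K * 2 powr s * (real b powr (\<gamma> - (1 + u) * s)) ^ r)"
        by (intro summable_mult summable_geometric) simp
      fix r
      have "real (card (S r)) * \<rho> r powr s \<le> K * real b powr (\<gamma> * real r) * \<rho> r powr s"
        by (intro mult_right_mono K) auto
      also have "\<dots> = K * real b powr (\<gamma> * real r) * (2 powr s * real b powr (- (1 + u) * real r * s))"
        by (simp add: \<rho>_def powr_mult powr_powr)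
      also have "\<dots> = K * 2 powr s * (real b powr (\<gamma> - (1 + u) * s)) ^ r"
        using b by (simp add: powr_power algebra_simps flip: powr_add)
      finally show "norm (real (card (S r)) * \<rho> r powr s)
          \<le> K * 2 powr s * (real b powr (\<gamma> - (1 + u) * s)) ^ r" by simp
    qed
    fix \<xi> assume \<xi>: "\<xi> \<in> E"
    have "{r. run_start b \<xi> r \<and> pow_dist b \<xi> r < real b powr (- u * real r)} \<subseteq> {r. \<exists>c\<in>S r. \<xi> \<in> I r c}"
    proof clarify
      fix r assume r: "run_start b \<xi> r" "pow_dist b \<xi> r < real b powr (- u * real r)"
      define c where "c = round (real b ^ r * \<xi>)"
      have "\<bar>\<xi> - of_int c / real b ^ r\<bar> = pow_dist b \<xi> r / real b ^ r"
      proof -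
        have "\<xi> - of_int c / real b ^ r = (real b ^ r * \<xi> - of_int c) / real b ^ r"
          using b by (simp add: field_simps)
        then show ?thesis by (simp add: abs_divide pow_dist_def dist_nearest_int_def c_def)
      qed
      also have "\<dots> \<le> real b powr (- u * real r) / real b ^ r"
        using r(2) by (intro divide_right_mono) auto
      also have "\<dots> = \<rho> r / 2"
      proof -
        have "- (1 + u) * real r = - u * real r - real r" by (simp add: algebra_simps)
        then show ?thesis using b by (simp only: \<rho>_def powr_diff) (simp add: powr_realpow)
      qed
      finally have "\<xi> \<in> I r c" unfolding I_def atLeastAtMost_iff by linarith
      moreover have "c \<in> S r" unfolding S_def c_def using \<xi> r(1) by blast
      ultimately show "\<exists>c\<in>S r. \<xi> \<in> I r c" by blast
    qed
    then show "infinite {r. \<exists>c\<in>S r. \<xi> \<in> I r c}"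
      using infinite_run_starts[OF \<xi>] finite_subset by blast
  qed
qed

end

section \<open>Cantor sets with prescribed zero digits\<close>

text \<open>Among sets of diameter at most 1 the gauge decreases in the exponent, so \<delta> is
  first replaced by its minimum with 1.\<close>

lemma hausdorff_measure_null_exponent_mono:
  fixes E :: "'a::metric_space set"
  assumes "0 \<le> s" "s \<le> t" "hausdorff_measure s E = 0"
  shows "hausdorff_measure t E = 0"
  unfolding hausdorff_measure_eq_0_iff
proof (intro allI impI)
  fix \<delta> :: real assume "0 < \<delta>"
  have gauge: "hausdorff_gauge t U \<le> hausdorff_gauge s U"
    if "bounded U" "diameter U \<le> 1" for U :: "'a set"
  proof (cases "U = {} \<or> t = 0")
    case True
    then show ?thesis using assms by (auto simp: hausdorff_gauge_def)
  next
    case False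
    have "diameter U powr t \<le> diameter U powr s"
      using assms diameter_ge_0[OF that(1)] that(2) by (intro powr_mono') auto
    moreover have "diameter U powr t \<le> 1"
      using assms diameter_ge_0[OF that(1)] that(2) by (intro powr_le1) auto
    ultimately show ?thesis
      using False by (simp add: hausdorff_gauge_def ennreal_leI flip: ennreal_1)
  qed
  have "hausdorff_premeasure t \<delta> E \<le> hausdorff_premeasure s (min \<delta> 1) E"
    unfolding hausdorff_premeasure_def[of s]
  proof (intro Inf_greatest, clarify)
    fix U :: "nat \<Rightarrow> 'a set"
    assume U: "E \<subseteq> (\<Union>i. U i)" "\<forall>i. bounded (U i) \<and> diameter (U i) \<le> min \<delta> 1"
    have "hausdorff_premeasure t \<delta> E \<le> (\<Sum>i. hausdorff_gauge t (U i))"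
      using U by (intro hausdorff_premeasure_le) auto
    also have "\<dots> \<le> (\<Sum>i. hausdorff_gauge s (U i))"
      using U(2) by (intro suminf_le gauge) auto
    finally show "hausdorff_premeasure t \<delta> E \<le> (\<Sum>i. hausdorff_gauge s (U i))" .
  qed
  also have "\<dots> = 0" using assms(3) \<open>0 < \<delta>\<close> by (simp add: hausdorff_measure_eq_0_iff)
  finally show "hausdorff_premeasure t \<delta> E = 0" by simp
qed

lemma hausdorff_dim_geI:
  assumes "hausdorff_measure s E \<noteq> 0"
  shows "ereal s \<le> hausdorff_dim E"
  unfolding hausdorff_dim_def
proof (rule Inf_greatest, clarify)
  fix t assume "0 \<le> t" "hausdorff_measure t E = 0"
  then show "ereal s \<le> ereal t"
    using hausdorff_measure_null_exponent_mono[of t s E] assms by (cases "t \<le> s") auto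
qed

section \<open>Digit expansions in base B\<close>

definition digit_val :: "nat \<Rightarrow> (nat \<Rightarrow> nat) \<Rightarrow> real" where
  "digit_val B e = (\<Sum>i. real (e i) / real B ^ Suc i)"

fun digit_prefix :: "nat \<Rightarrow> (nat \<Rightarrow> nat) \<Rightarrow> nat \<Rightarrow> nat" where
  "digit_prefix B e 0 = 0"
| "digit_prefix B e (Suc n) = B * digit_prefix B e n + e n"

context
  fixes B :: nat
  assumes B: "2 \<le> B"
begin

lemma digit_val_summable:
  assumes "\<And>i. e i < B"
  shows "summable (\<lambda>i. real (e i) / real B ^ Suc i)"
proof (rule summable_comparison_test')
  show "summable (\<lambda>i. (1 / real B) ^ i)" using B by (intro summable_geometric) auto
  fix i
  have "real (e i) / real B ^ Suc i \<le> real B / real B ^ Suc i"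
    using assms[of i] by (intro divide_right_mono) auto
  also have "\<dots> = (1 / real B) ^ i" using B by (simp add: power_one_over divide_simps)
  finally show "norm (real (e i) / real B ^ Suc i) \<le> (1 / real B) ^ i" by simp
qed

lemma digit_val_nonneg: "(\<And>i. e i < B) \<Longrightarrow> 0 \<le> digit_val B e"
  unfolding digit_val_def by (intro suminf_nonneg digit_val_summable) auto

lemma digit_val_step:
  assumes "\<And>i. e i < B"
  shows "real B * digit_val B e = real (e 0) + digit_val B (\<lambda>i. e (Suc i))"
proof -
  have "digit_val B e = real (e 0) / real B + (\<Sum>i. real (e (Suc i)) / real B ^ Suc (Suc i))"
    unfolding digit_val_def using suminf_split_head[OF digit_val_summable[of e]] assms by simp
  also have "(\<Sum>i. real (e (Suc i)) / real B ^ Suc (Suc i))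
      = (\<Sum>i. real (e (Suc i)) / real B ^ Suc i / real B)"
    by (simp add: mult.commute)
  also have "\<dots> = digit_val B (\<lambda>i. e (Suc i)) / real B"
    unfolding digit_val_def using assms by (intro suminf_divide digit_val_summable)
  finally show ?thesis using B by (simp add: field_simps)
qed

lemma digit_val_le_1:
  assumes "\<And>i. e i < B"
  shows "digit_val B e \<le> 1"
proof -
  have geo: "(\<lambda>i. (real B - 1) / real B * (1 / real B) ^ i) sums
      ((real B - 1) / real B * (1 / (1 - 1 / real B)))"
    using B by (intro sums_mult geometric_sums) auto
  have "digit_val B e \<le> (\<Sum>i. (real B - 1) / real B * (1 / real B) ^ i)"
    unfolding digit_val_def
  proof (intro suminf_le digit_val_summable assms)
    fix i
    have "real (e i) \<le> real B - 1" using assms[of i] by linarith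
    then have "real (e i) / real B ^ Suc i \<le> (real B - 1) / real B ^ Suc i"
      by (intro divide_right_mono) auto
    then show "real (e i) / real B ^ Suc i \<le> (real B - 1) / real B * (1 / real B) ^ i"
      by (simp add: power_one_over)
  qed (use geo sums_summable in blast)
  also have "\<dots> = 1" using sums_unique[OF geo] B by (simp add: field_simps)
  finally show ?thesis .
qed

lemma digit_val_split:
  assumes "\<And>i. e i < B"
  shows "real B ^ n * digit_val B e = real (digit_prefix B e n) + digit_val B (\<lambda>i. e (n + i))"
proof (induction n)
  case (Suc n)
  have "real B ^ Suc n * digit_val B e
      = real B * real (digit_prefix B e n) + real B * digit_val B (\<lambda>i. e (n + i))"
    using Suc by (simp add: mult.assoc distrib_left)
  also have "real B * digit_val B (\<lambda>i. e (n + i)) = real (e n) + digit_val B (\<lambda>i. e (Suc n + i))"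
    using digit_val_step[of "\<lambda>i. e (n + i)"] assms by simp
  finally show ?case by simp
qed simp

lemma digits_exist:
  assumes "0 \<le> x" "x < 1"
  obtains y where "\<And>j. y j < B"
    "\<And>n. real (digit_prefix B y n) \<le> real B ^ n * x \<and> real B ^ n * x < real (digit_prefix B y n) + 1"
proof -
  define y where "y = (\<lambda>j. nat (\<lfloor>real B ^ Suc j * x\<rfloor> mod int B))"
  have y: "y j < B" for j using B by (simp add: y_def nat_less_iff)
  have "int (digit_prefix B y n) = \<lfloor>real B ^ n * x\<rfloor>" for n
  proof (induction n)
    case 0
    then show ?case using assms by (simp add: floor_eq_iff)
  next
    case (Suc n)
    have "\<lfloor>real B ^ Suc n * x\<rfloor> div int B = \<lfloor>real B ^ Suc n * x / real_of_int (int B)\<rfloor>"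
      by (rule floor_divide_real_eq_div[symmetric]) simp
    also have "real B ^ Suc n * x / real_of_int (int B) = real B ^ n * x" using B by simp
    finally have "\<lfloor>real B ^ Suc n * x\<rfloor> div int B = int (digit_prefix B y n)" using Suc by simp
    moreover have "int (y n) = \<lfloor>real B ^ Suc n * x\<rfloor> mod int B" using B by (simp add: y_def)
    ultimately show ?case
      using mult_div_mod_eq[of "int B" "\<lfloor>real B ^ Suc n * x\<rfloor>"] by simp
  qed
  then have "real (digit_prefix B y n) = of_int \<lfloor>real B ^ n * x\<rfloor>" for n
    by (metis of_int_of_nat_eq)
  then show ?thesis using that[of y] y by (simp add: floor_less_cancel)
qed

end

section \<open>Cantor sets with free digits outside Z, and their Hausdorff measure\<close>

locale digit_cantor =
  fixes B :: nat and Z :: "nat set"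
  assumes B: "4 \<le> B"
begin

definition free_rank :: "nat \<Rightarrow> nat" where
  "free_rank n = card {i. i < n \<and> i \<notin> Z}"

text \<open>
  Free digits avoid the extreme values \<open>0\<close> and \<open>B - 1\<close>, so that all runs of extreme digits
  lie inside \<open>Z\<close>.
\<close>

definition free_embed :: "(nat \<Rightarrow> nat) \<Rightarrow> nat \<Rightarrow> nat" where
  "free_embed y i = (if i \<in> Z then 0 else Suc (y (free_rank i)))"

definition cantor :: "real set" where
  "cantor = {digit_val B (free_embed y) | y. \<forall>j. y j < B - 2}"

lemma free_rank_0 [simp]: "free_rank 0 = 0"
  by (simp add: free_rank_def)

lemma free_rank_Suc: "free_rank (Suc n) = (if n \<in> Z then free_rank n else Suc (free_rank n))"
proof -
  have "{i. i < Suc n \<and> i \<notin> Z} =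
      (if n \<in> Z then {i. i < n \<and> i \<notin> Z} else insert n {i. i < n \<and> i \<notin> Z})"
    by (auto simp: less_Suc_eq)
  then show ?thesis by (simp add: free_rank_def)
qed

lemma free_embed_less:
  assumes "\<And>j. y j < B - 2"
  shows "free_embed y i < B"
  using assms[of "free_rank i"] B by (simp add: free_embed_def less_diff_conv)

lemma free_embed_free:
  assumes "\<And>j. y j < B - 2" "i \<notin> Z"
  shows "1 \<le> free_embed y i" "free_embed y i + 2 \<le> B"
  using assms(1)[of "free_rank i"] assms(2) B by (simp_all add: free_embed_def less_diff_conv)

text \<open>Division with remainder by B peels off the last digit. Hence all parameters that share a
  prefix of length n lie in one interval of length (B - 2)^(-\<open>free_rank n\<close>).\<close>

lemma digit_prefix_free_embed:
  assumes "\<And>j. y j < B - 2" "\<And>j. y' j < B - 2"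
    and "digit_prefix B (free_embed y) n = digit_prefix B (free_embed y') n"
  shows "digit_prefix (B - 2) y (free_rank n) = digit_prefix (B - 2) y' (free_rank n)"
  using assms(3)
proof (induction n)
  case (Suc n)
  have less: "free_embed y n < B" "free_embed y' n < B" using free_embed_less assms by blast+
  have "(B * digit_prefix B (free_embed y) n + free_embed y n) div B
      = (B * digit_prefix B (free_embed y') n + free_embed y' n) div B"
    "(B * digit_prefix B (free_embed y) n + free_embed y n) mod B
      = (B * digit_prefix B (free_embed y') n + free_embed y' n) mod B"
    using Suc.prems by simp_all
  then have "digit_prefix B (free_embed y) n = digit_prefix B (free_embed y') n" "free_embed y n = free_embed y' n"
    using less by simp_all
  with Suc.IH[OF this(1)] show ?case by (simp add: free_rank_Suc free_embed_def split: if_splits)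
qed simp

text \<open>After scaling by B^n two points of U differ by at most 1 and their tails by at most 1,
  so at most five integer prefixes occur. The measurable set J replaces the preimage, whose own
  measurability is never at issue.\<close>

lemma cantor_preimage_cover:
  assumes y: "\<And>x j. y x j < B - 2"
    "\<And>x n. 0 \<le> x \<Longrightarrow> x < 1 \<Longrightarrow> real (digit_prefix (B - 2) (y x) n) \<le> real (B - 2) ^ n * x
        \<and> real (B - 2) ^ n * x < real (digit_prefix (B - 2) (y x) n) + 1"
    and U: "bounded U" "diameter U \<le> 1 / real B ^ n"
  obtains J where "J \<in> sets lborel"
    "{x. 0 \<le> x \<and> x < 1 \<and> digit_val B (free_embed (y x)) \<in> U} \<subseteq> J"
    "emeasure lborel J \<le> ennreal (5 / real (B - 2) ^ free_rank n)"
proof (cases "{x. 0 \<le> x \<and> x < 1 \<and> digit_val B (free_embed (y x)) \<in> U} = {}")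
  case True
  then show ?thesis using that[of "{}"] by simp
next
  case False
  define X where "X = {x. 0 \<le> x \<and> x < 1 \<and> digit_val B (free_embed (y x)) \<in> U}"
  obtain x0 where x0: "x0 \<in> X" using False unfolding X_def by blast
  define P where "P = (\<lambda>x. int (digit_prefix B (free_embed (y x)) n))"
  \<comment> \<open>Any parameter with prefix p may serve as representative, since all of them share
    the first \<open>free_rank n\<close> digits.\<close>
  define Y where "Y = (\<lambda>p. real (digit_prefix (B - 2) (y (SOME x. x \<in> X \<and> P x = p)) (free_rank n)))"
  define L where "L = 1 / real (B - 2) ^ free_rank n"
  have L: "0 < L" using B by (simp add: L_def)
  define J where "J = (\<Union>p\<in>{P x0 - 2..P x0 + 2}. {L * Y p..L * (Y p + 1)})"
  have "X \<subseteq> J"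
  proof
    fix x assume x: "x \<in> X"
    have eq: "real B ^ n * digit_val B (free_embed (y x')) = real_of_int (P x')
        + digit_val B (\<lambda>i. free_embed (y x') (n + i))" for x'
      using digit_val_split[of B "free_embed (y x')"] B free_embed_less y(1) by (simp add: P_def)
    have tail: "0 \<le> digit_val B (\<lambda>i. free_embed (y x') (n + i))"
      "digit_val B (\<lambda>i. free_embed (y x') (n + i)) \<le> 1" for x'
      using B free_embed_less y(1) by (auto intro!: digit_val_nonneg digit_val_le_1)
    have "dist (digit_val B (free_embed (y x))) (digit_val B (free_embed (y x0))) \<le> diameter U"
      using x x0 U(1) by (intro diameter_bounded_bound) (auto simp: X_def)
    then have "\<bar>digit_val B (free_embed (y x)) - digit_val B (free_embed (y x0))\<bar> \<le> 1 / real B ^ n"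
      using U(2) by (simp add: dist_real_def)
    then have "real B ^ n * \<bar>digit_val B (free_embed (y x)) - digit_val B (free_embed (y x0))\<bar> \<le> 1"
      using B by (simp add: field_simps)
    then have "\<bar>real B ^ n * digit_val B (free_embed (y x)) - real B ^ n * digit_val B (free_embed (y x0))\<bar> \<le> 1"
      by (simp add: abs_mult flip: right_diff_distrib)
    then have "\<bar>real_of_int (P x) - real_of_int (P x0)\<bar> \<le> 2"
      using eq[of x] eq[of x0] tail[of x] tail[of x0] by linarith
    then have "P x \<in> {P x0 - 2..P x0 + 2}" by auto
    moreover have "x \<in> {L * Y (P x)..L * (Y (P x) + 1)}"
    proof -
      define x' where "x' = (SOME z. z \<in> X \<and> P z = P x)"
      have "x' \<in> X \<and> P x' = P x" unfolding x'_def by (rule someI[of _ x]) (use x in simp)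
      then have "digit_prefix (B - 2) (y x) (free_rank n) = digit_prefix (B - 2) (y x') (free_rank n)"
        using y(1) by (intro digit_prefix_free_embed) (auto simp: P_def)
      then have "Y (P x) = real (digit_prefix (B - 2) (y x) (free_rank n))"
        by (simp add: Y_def x'_def)
      then have "Y (P x) \<le> real (B - 2) ^ free_rank n * x" "real (B - 2) ^ free_rank n * x \<le> Y (P x) + 1"
        using y(2)[of x "free_rank n"] x by (auto simp: X_def)
      then have "L * Y (P x) \<le> L * (real (B - 2) ^ free_rank n * x)"
        "L * (real (B - 2) ^ free_rank n * x) \<le> L * (Y (P x) + 1)"
        using L by simp_all
      moreover have "L * (real (B - 2) ^ free_rank n * x) = x" using B by (simp add: L_def)
      ultimately show ?thesis by simp
    qed
    ultimately show "x \<in> J" unfolding J_def by blast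
  qed
  moreover have "emeasure lborel J \<le> ennreal (5 / real (B - 2) ^ free_rank n)"
  proof -
    have "emeasure lborel J \<le> (\<Sum>p\<in>{P x0 - 2..P x0 + 2}. emeasure lborel {L * Y p..L * (Y p + 1)})"
      unfolding J_def by (intro emeasure_subadditive_finite) auto
    also have "\<dots> = (\<Sum>p\<in>{P x0 - 2..P x0 + 2}. ennreal L)"
      using L by (intro sum.cong) (auto simp: algebra_simps)
    also have "\<dots> = ennreal (5 * L)" using L by (simp add: ennreal_mult)
    finally show ?thesis by (simp add: L_def)
  qed
  moreover have "J \<in> sets lborel" unfolding J_def by auto
  ultimately show ?thesis using that[of J] unfolding X_def by blast
qed

text \<open>
  Reading the free digits as a base \<open>B - 2\<close> expansion maps the Cantor set onto \<open>[0, 1)\<close>;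
  Lebesgue measure there plays the role of a mass distribution.
\<close>

theorem hausdorff_measure_cantor:
  assumes s: "0 < s" and C: "0 < C"
    and rank_ge: "\<And>n. 1 / real (B - 2) ^ free_rank n \<le> C * real B powr (- s * real n)"
  shows "hausdorff_measure s cantor \<noteq> 0"
proof
  assume null: "hausdorff_measure s cantor = 0"
  have "\<exists>y. (\<forall>j. y j < B - 2) \<and> (0 \<le> x \<longrightarrow> x < 1 \<longrightarrow>
      (\<forall>n. real (digit_prefix (B - 2) y n) \<le> real (B - 2) ^ n * x
        \<and> real (B - 2) ^ n * x < real (digit_prefix (B - 2) y n) + 1))" for x :: real
  proof (cases "0 \<le> x \<and> x < 1")
    case True
    \<comment> \<open>With B \<ge> 4 there are at least two admissible digits, so the free digits
      can themselves be read as an expansion.\<close>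
    have "2 \<le> B - 2" using B by simp
    from digits_exist[OF this conjunct1[OF True] conjunct2[OF True]] show ?thesis by metis
  next
    case False
    then show ?thesis using B by (intro exI[of _ "\<lambda>_. 0"]) auto
  qed
  then obtain y where y: "\<And>x j. y x j < B - 2"
    "\<And>x n. 0 \<le> x \<Longrightarrow> x < 1 \<Longrightarrow> real (digit_prefix (B - 2) (y x) n) \<le> real (B - 2) ^ n * x
        \<and> real (B - 2) ^ n * x < real (digit_prefix (B - 2) (y x) n) + 1"
    by metis
  define X where "X = (\<lambda>U. {x. 0 \<le> x \<and> x < 1 \<and> digit_val B (free_embed (y x)) \<in> U})"
  \<comment> \<open>The factor 5 counts prefixes, \<open>C\<close> comes from the rank bound, and
    B^s from rounding the diameter up to a power of 1 / B.\<close>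
  define C' where "C' = 5 * C * real B powr s"
  have C': "0 < C'" using C B by (simp add: C'_def)
  have cover: "\<exists>J. J \<in> sets lborel \<and> X U \<subseteq> J \<and>
      emeasure lborel J \<le> ennreal C' * hausdorff_gauge s U + ennreal \<epsilon>"
    if U: "bounded U" "diameter U \<le> 1" and \<epsilon>: "0 < \<epsilon>" for U \<epsilon>
  proof (cases "U = {}")
    case True
    then show ?thesis by (intro exI[of _ "{}"]) (auto simp: X_def)
  next
    case False
    have "\<exists>n. diameter U \<le> 1 / real B ^ n \<and>
        5 / real (B - 2) ^ free_rank n \<le> C' * diameter U powr s + \<epsilon>"
    proof (cases "diameter U = 0")
      case True
      \<comment> \<open>A set of diameter 0 has gauge 0, so its preimage must have arbitrarily small
        measure; this is why the cover is allowed an error \<epsilon>.\<close>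
      have "real B powr (- s) < 1" using B s powr_less_cancel_iff[of "real B" "- s" 0] by simp
      then obtain n where "(real B powr (- s)) ^ n < \<epsilon> / (5 * C)"
        using real_arch_pow_inv[of "\<epsilon> / (5 * C)"] \<epsilon> C by auto
      then have "5 * (C * real B powr (- s * real n)) < \<epsilon>"
        using C B by (simp add: powr_power field_simps)
      then have "5 / real (B - 2) ^ free_rank n \<le> \<epsilon>" using rank_ge[of n] by simp
      then show ?thesis using True by (intro exI[of _ n]) simp
    next
      case False
      then have d: "0 < diameter U" using diameter_ge_0[OF U(1)] by simp
      \<comment> \<open>The level m = n - 1 is the one with diameter U \<le> B^(-m) \<le> B *
        diameter U.\<close>
      define n where "n = (LEAST n. (1 / real B) ^ n < diameter U)"
      have "\<exists>n. (1 / real B) ^ n < diameter U" using d B by (intro real_arch_pow_inv) auto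
      then have n: "(1 / real B) ^ n < diameter U" unfolding n_def by (rule LeastI_ex)
      then obtain m where m: "n = Suc m" using U(2) by (cases n) auto
      have "\<not> (1 / real B) ^ m < diameter U" using m unfolding n_def by (intro not_less_Least) simp
      then have 1: "diameter U \<le> 1 / real B ^ m" by (simp add: power_one_over)
      have "1 / real B ^ m \<le> real B * diameter U"
        using n B by (simp add: m power_one_over field_simps)
      then have "(1 / real B ^ m) powr s \<le> (real B * diameter U) powr s"
        using s by (intro powr_mono2) auto
      moreover have "real B powr (- s * real m) = (1 / real B ^ m) powr s"
        using B by (simp add: powr_minus_divide powr_divide powr_powr mult.commute flip: powr_realpow)
      ultimately have "real B powr (- s * real m) \<le> real B powr s * diameter U powr s"
        by (simp add: powr_mult)
      then have "5 * (C * real B powr (- s * real m)) \<le> 5 * (C * (real B powr s * diameter U powr s))"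
        using C by (intro mult_left_mono) auto
      then have "5 / real (B - 2) ^ free_rank m \<le> C' * diameter U powr s"
        using rank_ge[of m] by (simp add: C'_def mult.assoc)
      then show ?thesis using 1 \<epsilon> by (intro exI[of _ m]) simp
    qed
    then obtain n where n: "diameter U \<le> 1 / real B ^ n"
      "5 / real (B - 2) ^ free_rank n \<le> C' * diameter U powr s + \<epsilon>" by blast
    obtain J where J: "J \<in> sets lborel" "X U \<subseteq> J"
      "emeasure lborel J \<le> ennreal (5 / real (B - 2) ^ free_rank n)"
      using cantor_preimage_cover[OF y U(1) n(1)] unfolding X_def by blast
    have "ennreal (5 / real (B - 2) ^ free_rank n) \<le> ennreal (C' * diameter U powr s + \<epsilon>)"
      using n(2) by (rule ennreal_leI)
    also have "\<dots> = ennreal C' * hausdorff_gauge s U + ennreal \<epsilon>"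
      using False s \<epsilon> C' by (simp add: hausdorff_gauge_def ennreal_mult)
    finally show ?thesis using J order_trans by blast
  qed
  have "hausdorff_premeasure s 1 cantor = 0" using null by (simp add: hausdorff_measure_eq_0_iff)
  \<comment> \<open>This budget and the errors \<epsilon> each contribute at most 1/4, so that [0,
    1) would have measure at most 1/2.\<close>
  then have "hausdorff_premeasure s 1 cantor < ennreal (1 / (4 * C'))" using C' by simp
  then obtain U where U: "cantor \<subseteq> (\<Union>i. U i)" "\<And>i. bounded (U i)" "\<And>i. diameter (U i) \<le> 1"
    "(\<Sum>i. hausdorff_gauge s (U i)) < ennreal (1 / (4 * C'))"
    unfolding hausdorff_premeasure_def Inf_less_iff by blast
  have "\<exists>J. J \<in> sets lborel \<and> X (U i) \<subseteq> J \<and>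
      emeasure lborel J \<le> ennreal C' * hausdorff_gauge s (U i) + ennreal (1 / 4 * (1 / 2) ^ Suc i)" for i
    using U(2,3) by (intro cover) auto
  then obtain J where J: "\<And>i. J i \<in> sets lborel" "\<And>i. X (U i) \<subseteq> J i"
    "\<And>i. emeasure lborel (J i) \<le> ennreal C' * hausdorff_gauge s (U i) + ennreal (1 / 4 * (1 / 2) ^ Suc i)"
    by metis
  have "{0..<1} \<subseteq> (\<Union>i. J i)"
  proof
    fix x :: real assume x: "x \<in> {0..<1}"
    have "digit_val B (free_embed (y x)) \<in> cantor" unfolding cantor_def using y(1) by blast
    then obtain i where "digit_val B (free_embed (y x)) \<in> U i" using U(1) by blast
    then have "x \<in> X (U i)" using x by (simp add: X_def)
    then show "x \<in> (\<Union>i. J i)" using J(2) by blast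
  qed
  then have "emeasure lborel {0..<1::real} \<le> emeasure lborel (\<Union>i. J i)"
    using J(1) by (intro emeasure_mono) auto
  then have "1 \<le> emeasure lborel (\<Union>i. J i)" by simp
  also have "\<dots> \<le> (\<Sum>i. emeasure lborel (J i))"
    using J(1) by (intro emeasure_subadditive_countably) auto
  also have "\<dots> \<le> (\<Sum>i. ennreal C' * hausdorff_gauge s (U i) + ennreal (1 / 4 * (1 / 2) ^ Suc i))"
    by (intro suminf_le J) auto
  also have "\<dots> = ennreal C' * (\<Sum>i. hausdorff_gauge s (U i)) + (\<Sum>i. ennreal (1 / 4 * (1 / 2) ^ Suc i))"
    by (subst suminf_add[symmetric]) auto
  also have "(\<Sum>i. ennreal (1 / 4 * (1 / 2) ^ Suc i)) = ennreal (1 / 4)"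
    using sums_mult[OF power_half_series, of "1 / 4"] by (intro suminf_ennreal_eq) auto
  also have "ennreal C' * (\<Sum>i. hausdorff_gauge s (U i)) + ennreal (1 / 4)
      \<le> ennreal C' * ennreal (1 / (4 * C')) + ennreal (1 / 4)"
    using U(4) by (intro add_right_mono mult_left_mono) auto
  also have "\<dots> = ennreal (1 / 2)"
    using C' by (simp flip: ennreal_mult ennreal_plus)
  finally have "ennreal 1 \<le> ennreal (1 / 2)" unfolding ennreal_1 .
  then show False by (subst (asm) ennreal_le_iff) simp_all
qed

end

section \<open>Geometrically growing zero blocks\<close>

text \<open>The constant \<kappa> is a lower density of free positions below \<theta>^k. Starting at
  level \<open>k0\<close> makes the slack in each gap at least 1, which pays for counting integers
  between real endpoints, and makes each block longer than 1, so that it contains an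
  integer.\<close>

locale zero_blocks =
  fixes B k0 :: nat and \<theta> w \<kappa> :: real
  assumes B: "4 \<le> B" and w: "0 < w" and \<theta>: "1 < \<theta>" and gap: "1 + \<theta> * w < \<theta>"
    and \<kappa>: "0 \<le> \<kappa>" "1 \<le> (\<theta> - (1 + \<theta> * w) - \<kappa> * (\<theta> - 1)) * \<theta> ^ k0"
    and block: "1 < \<theta> * w * \<theta> ^ k0"
begin

definition \<tau> :: real where "\<tau> = 1 + \<theta> * w"

definition Z :: "nat set" where
  "Z = {j. \<exists>k\<ge>k0. \<theta> ^ k \<le> real j \<and> real j < \<tau> * \<theta> ^ k}"

sublocale digit_cantor B Z
  by unfold_locales (rule B)

lemma tau: "1 < \<tau>" "\<tau> < \<theta>"
  using gap \<theta> w by (auto simp: \<tau>_def)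

lemma theta_power_mono: "k \<le> l \<Longrightarrow> \<theta> ^ k \<le> \<theta> ^ l"
  using \<theta> by (intro power_increasing) auto

lemma theta_power_pos: "0 < \<theta> ^ k"
  using \<theta> by simp

lemma slope: "0 < \<theta> - \<tau> - \<kappa> * (\<theta> - 1)"
proof (rule ccontr)
  assume "\<not> 0 < \<theta> - \<tau> - \<kappa> * (\<theta> - 1)"
  then have "(\<theta> - \<tau> - \<kappa> * (\<theta> - 1)) * \<theta> ^ k0 \<le> 0"
    using theta_power_pos[of k0] by (intro mult_nonpos_nonneg) auto
  then show False using \<kappa>(2) by (simp add: \<tau>_def)
qed

lemma growth: "k0 \<le> k \<Longrightarrow> 1 \<le> (\<theta> - \<tau> - \<kappa> * (\<theta> - 1)) * \<theta> ^ k"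
proof -
  assume "k0 \<le> k"
  have "(\<theta> - \<tau> - \<kappa> * (\<theta> - 1)) * \<theta> ^ k0 \<le> (\<theta> - \<tau> - \<kappa> * (\<theta> - 1)) * \<theta> ^ k"
    using theta_power_mono[OF \<open>k0 \<le> k\<close>] slope by (intro mult_left_mono) auto
  then show ?thesis using \<kappa>(2) by (simp add: \<tau>_def)
qed

lemma gap_length: "k0 \<le> k \<Longrightarrow> \<tau> * \<theta> ^ k + 1 \<le> \<theta> ^ Suc k"
proof -
  assume "k0 \<le> k"
  have "0 \<le> \<kappa> * (\<theta> - 1) * \<theta> ^ k" using \<kappa> \<theta> by simp
  then show ?thesis using growth[OF \<open>k0 \<le> k\<close>] by (simp add: algebra_simps)
qed

lemma block_length: "k0 \<le> k \<Longrightarrow> \<theta> ^ k + 1 < \<tau> * \<theta> ^ k"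
proof -
  assume "k0 \<le> k"
  then have "\<theta> * w * \<theta> ^ k0 \<le> \<theta> * w * \<theta> ^ k"
    using theta_power_mono \<theta> w by (intro mult_left_mono) auto
  then show ?thesis using block by (simp add: \<tau>_def algebra_simps)
qed

lemma level_exists:
  assumes "\<theta> ^ k0 \<le> x"
  obtains k where "k0 \<le> k" "\<theta> ^ k \<le> x" "x < \<theta> ^ Suc k"
proof -
  define n where "n = (LEAST n. x < \<theta> ^ n)"
  have "\<exists>n. x < \<theta> ^ n" using \<theta> by (rule real_arch_pow)
  then have n: "x < \<theta> ^ n" unfolding n_def by (rule LeastI_ex)
  have "k0 < n" using n assms theta_power_mono[of n k0] by (meson le_less_linear order.strict_trans1 not_le)
  then obtain k where k: "n = Suc k" "k0 \<le> k" by (cases n) auto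
  have "\<not> x < \<theta> ^ k" using k unfolding n_def by (intro not_less_Least) simp
  then show ?thesis using that[of k] k n by simp
qed

lemma Z_iff:
  assumes "k0 \<le> k" "\<theta> ^ k \<le> real j" "real j < \<theta> ^ Suc k"
  shows "j \<in> Z \<longleftrightarrow> real j < \<tau> * \<theta> ^ k"
proof
  assume "j \<in> Z"
  then obtain k' where k': "\<theta> ^ k' \<le> real j" "real j < \<tau> * \<theta> ^ k'" unfolding Z_def by blast
  have "\<tau> * \<theta> ^ k' \<le> \<theta> ^ Suc k'" using tau theta_power_pos[of k'] by simp
  then have "\<theta> ^ k' < \<theta> ^ Suc k" "\<theta> ^ k < \<theta> ^ Suc k'" using k' assms by linarith+
  then have "k' < Suc k" "k < Suc k'" using \<theta> power_less_imp_less_exp by blast+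
  then show "real j < \<tau> * \<theta> ^ k" using k'(2) by (simp add: less_Suc_eq_le)
next
  assume "real j < \<tau> * \<theta> ^ k"
  then show "j \<in> Z" unfolding Z_def using assms by blast
qed

subsection \<open>Counting free positions\<close>

text \<open>Block endpoints are real numbers, so the count is needed at real arguments.\<close>

definition free_count :: "real \<Rightarrow> nat" where
  "free_count x = card {i. real i < x \<and> i \<notin> Z}"

lemma finite_below: "finite {i::nat. real i < x \<and> P i}"
proof (rule finite_subset)
  show "{i::nat. real i < x \<and> P i} \<subseteq> {..nat \<lceil>x\<rceil>}" by (auto, linarith)
qed simp

lemma free_count_mono: "x \<le> y \<Longrightarrow> free_count x \<le> free_count y"
  unfolding free_count_def by (intro card_mono finite_below) auto

lemma free_count_gap:
  assumes "0 \<le> y" "y \<le> x" and free: "\<And>i. y \<le> real i \<Longrightarrow> real i < x \<Longrightarrow> i \<notin> Z"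
  shows "real (free_count y) + (x - y) - 1 \<le> real (free_count x)"
proof -
  have eq: "{nat \<lceil>y\<rceil>..<nat \<lceil>x\<rceil>} = {i. y \<le> real i \<and> real i < x}"
    using assms(1) by (auto simp: nat_le_iff ceiling_le_iff less_ceiling_iff zless_nat_eq_int_zless)
  have "card {i. y \<le> real i \<and> real i < x} = nat \<lceil>x\<rceil> - nat \<lceil>y\<rceil>"
    by (simp flip: eq)
  then have len: "x - y - 1 \<le> real (card {i. y \<le> real i \<and> real i < x})" using assms by linarith
  have "{i. real i < y \<and> i \<notin> Z} \<union> {i. y \<le> real i \<and> real i < x} \<subseteq> {i. real i < x \<and> i \<notin> Z}"
    using assms(2) free by auto
  then have "card ({i. real i < y \<and> i \<notin> Z} \<union> {i. y \<le> real i \<and> real i < x}) \<le> free_count x"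
    unfolding free_count_def by (intro card_mono finite_below)
  moreover have "card ({i. real i < y \<and> i \<notin> Z} \<union> {i. y \<le> real i \<and> real i < x})
      = free_count y + card {i. y \<le> real i \<and> real i < x}"
    unfolding free_count_def
  proof (intro card_Un_disjoint finite_below)
    show "finite {i. y \<le> real i \<and> real i < x}" by (simp flip: eq)
  qed auto
  ultimately show ?thesis using len by linarith
qed

lemma free_count_between:
  assumes "k0 \<le> k" "\<tau> * \<theta> ^ k \<le> x" "x \<le> \<theta> ^ Suc k"
  shows "real (free_count (\<tau> * \<theta> ^ k)) + (x - \<tau> * \<theta> ^ k) - 1 \<le> real (free_count x)"
proof (rule free_count_gap)
  fix i assume i: "\<tau> * \<theta> ^ k \<le> real i" "real i < x"
  have "\<theta> ^ k \<le> \<tau> * \<theta> ^ k" using tau theta_power_pos[of k] by simp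
  then show "i \<notin> Z" using i assms by (subst Z_iff[of k]) auto
qed (use assms tau theta_power_pos[of k] in auto)

text \<open>The gap after block k contributes at least (\<theta> - \<tau>) \<theta>^k - 1 free
  positions, and by \<open>growth\<close> this is at least \<kappa> (\<theta>^(k+1) - \<theta>^k);
  the sum telescopes.\<close>

lemma free_count_power:
  assumes "k0 \<le> k"
  shows "\<kappa> * (\<theta> ^ k - \<theta> ^ k0) \<le> real (free_count (\<theta> ^ k))"
  using assms
proof (induction k rule: nat_induct_at_least)
  case (Suc k)
  have "\<theta> ^ k \<le> \<tau> * \<theta> ^ k" using tau theta_power_pos[of k] by simp
  then have "real (free_count (\<theta> ^ k)) \<le> real (free_count (\<tau> * \<theta> ^ k))"
    using free_count_mono by simp
  moreover have "real (free_count (\<tau> * \<theta> ^ k)) + (\<theta> ^ Suc k - \<tau> * \<theta> ^ k) - 1 \<le> real (free_count (\<theta> ^ Suc k))"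
    using gap_length[OF Suc.hyps] by (intro free_count_between Suc.hyps) auto
  moreover have "1 \<le> (\<theta> - \<tau> - \<kappa> * (\<theta> - 1)) * \<theta> ^ k" by (rule growth[OF Suc.hyps])
  ultimately show ?case using Suc.IH by (simp add: algebra_simps)
qed simp

text \<open>The bound is tightest at the end \<tau> \<theta>^k of a block, where \<kappa> \<theta>^k
  is compared with \<tau> \<theta>^k. In the following gap the count grows with slope 1, which is at
  least \<kappa> / \<tau>.\<close>

lemma free_rank_ge: "\<kappa> / \<tau> * real n - (\<kappa> * \<theta> ^ k0 + 1) \<le> real (free_rank n)"
proof -
  have rank: "free_rank n = free_count (real n)" by (simp add: free_rank_def free_count_def)
  have "\<kappa> \<le> 1"
  proof (rule ccontr)
    assume "\<not> \<kappa> \<le> 1"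
    then have "1 * (\<theta> - 1) \<le> \<kappa> * (\<theta> - 1)" using \<theta> by (intro mult_right_mono) auto
    then show False using slope tau(1) by simp
  qed
  then have c: "0 \<le> \<kappa> / \<tau>" "\<kappa> / \<tau> \<le> 1" using tau \<kappa> by auto
  show ?thesis
  proof (cases "\<theta> ^ k0 \<le> real n")
    case False
    have "\<kappa> / \<tau> * real n \<le> \<kappa> * \<theta> ^ k0"
      using False \<kappa> tau by (intro mult_mono) (auto simp: divide_le_eq mult_le_cancel_left1)
    then show ?thesis by simp
  next
    case True
    then obtain k where k: "k0 \<le> k" "\<theta> ^ k \<le> real n" "real n < \<theta> ^ Suc k"
      by (rule level_exists)
    have 1: "\<kappa> * (\<theta> ^ k - \<theta> ^ k0) \<le> real (free_count (\<theta> ^ k))" by (rule free_count_power[OF k(1)])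
    show ?thesis
    proof (cases "real n < \<tau> * \<theta> ^ k")
      case True
      have "\<kappa> / \<tau> * real n \<le> \<kappa> / \<tau> * (\<tau> * \<theta> ^ k)" using True c by (intro mult_left_mono) auto
      also have "\<dots> = \<kappa> * \<theta> ^ k" using tau by simp
      finally have "\<kappa> / \<tau> * real n \<le> \<kappa> * \<theta> ^ k" .
      moreover have "real (free_count (\<theta> ^ k)) \<le> real (free_rank n)"
        using free_count_mono[OF k(2)] rank by simp
      ultimately show ?thesis using 1 by (simp add: algebra_simps)
    next
      case False
      have "\<theta> ^ k \<le> \<tau> * \<theta> ^ k" using tau theta_power_pos[of k] by simp
      then have "real (free_count (\<theta> ^ k)) \<le> real (free_count (\<tau> * \<theta> ^ k))"
        using free_count_mono by simp
      moreover have "real (free_count (\<tau> * \<theta> ^ k)) + (real n - \<tau> * \<theta> ^ k) - 1 \<le> real (free_rank n)"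
        unfolding rank using False k by (intro free_count_between) auto
      moreover have "\<kappa> / \<tau> * (real n - \<tau> * \<theta> ^ k) \<le> 1 * (real n - \<tau> * \<theta> ^ k)"
        using False c by (intro mult_right_mono) auto
      then have "\<kappa> / \<tau> * real n - \<kappa> * \<theta> ^ k \<le> real n - \<tau> * \<theta> ^ k"
        using tau by (simp add: right_diff_distrib)
      ultimately show ?thesis using 1 by (simp add: algebra_simps)
    qed
  qed
qed

subsection \<open>Exponents of the points of the Cantor set\<close>

lemma B_powr_mono: "x \<le> y \<Longrightarrow> real B powr x \<le> real B powr y"
  using B by (intro powr_mono) auto

context
  fixes y :: "nat \<Rightarrow> nat"
  assumes y: "\<And>j. y j < B - 2"
begin

definition tail :: "nat \<Rightarrow> real" where
  "tail j = digit_val B (\<lambda>i. free_embed y (j + i))"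

abbreviation \<xi> :: real where "\<xi> \<equiv> digit_val B (free_embed y)"

lemma tail_bounds: "0 \<le> tail j" "tail j \<le> 1"
  unfolding tail_def using B free_embed_less[OF y] by (auto intro!: digit_val_nonneg digit_val_le_1)

lemma pow_dist_tail: "pow_dist B \<xi> j \<le> tail j" "min (tail j) (1 - tail j) \<le> pow_dist B \<xi> j"
proof -
  have eq: "real B ^ j * \<xi> = of_int (int (digit_prefix B (free_embed y) j)) + tail j"
    using digit_val_split[of B "free_embed y" j] B free_embed_less[OF y] by (simp add: tail_def)
  show "pow_dist B \<xi> j \<le> tail j"
    using dist_nearest_int_le[of "real B ^ j * \<xi>" "int (digit_prefix B (free_embed y) j)"] tail_bounds(1)[of j]
    unfolding pow_dist_def eq by simp
  show "min (tail j) (1 - tail j) \<le> pow_dist B \<xi> j"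
    unfolding pow_dist_def eq by (intro dist_nearest_int_add_int tail_bounds)
qed

lemma tail_free:
  assumes "j \<notin> Z"
  shows "1 / real B \<le> tail j" "tail j \<le> 1 - 1 / real B"
proof -
  have eq: "real B * tail j = real (free_embed y j) + tail (Suc j)"
    using digit_val_step[of B "\<lambda>i. free_embed y (j + i)"] B free_embed_less[OF y] by (simp add: tail_def)
  have "1 \<le> real (free_embed y j)" "real (free_embed y j) + 2 \<le> real B"
    using free_embed_free[where y=y, OF y assms] by linarith+
  then have "1 \<le> real B * tail j" "real B * tail j \<le> real B - 1"
    using eq tail_bounds[of "Suc j"] by linarith+
  then show "1 / real B \<le> tail j" "tail j \<le> 1 - 1 / real B" using B by (simp_all add: field_simps)
qed

lemma tail_zeros:
  assumes "\<And>i. j \<le> i \<Longrightarrow> i < j + d \<Longrightarrow> i \<in> Z"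
  shows "tail j = tail (j + d) / real B ^ d"
proof -
  have "digit_prefix B (\<lambda>i. free_embed y (j + i)) n = 0" if "n \<le> d" for n
    using that by (induction n) (auto simp: assms free_embed_def)
  then have "real B ^ d * tail j = tail (j + d)"
    using digit_val_split[of B "\<lambda>i. free_embed y (j + i)" d] B free_embed_less[OF y]
    by (simp add: tail_def add.assoc)
  then show ?thesis using B by (simp add: field_simps)
qed

lemma pow_dist_free: "j \<notin> Z \<Longrightarrow> real B powr (- 1) \<le> pow_dist B \<xi> j"
  using tail_free[of j] pow_dist_tail(2)[of j] by (simp add: powr_minus_divide min_def split: if_splits)

text \<open>From j on, only zeros occur up to the first integer m past the block, and m is free. So
  the tail at j is B^(j - m) times a number between 1 / B and 1; rounding the block end up to m
  costs one more factor B.\<close>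

lemma pow_dist_block:
  assumes k: "k0 \<le> k" and j: "\<theta> ^ k \<le> real j" "real j < \<tau> * \<theta> ^ k"
  shows "pow_dist B \<xi> j \<le> real B powr (real j - \<tau> * \<theta> ^ k)"
    and "real B powr (real j - \<tau> * \<theta> ^ k - 2) \<le> pow_dist B \<xi> j"
proof -
  define m where "m = nat \<lceil>\<tau> * \<theta> ^ k\<rceil>"
  have m: "\<tau> * \<theta> ^ k \<le> real m" "real m < \<tau> * \<theta> ^ k + 1"
    unfolding m_def using j by linarith+
  then have jm: "j < m" using j by linarith
  have in_Z: "i \<in> Z" if "j \<le> i" "i < m" for i
  proof -
    have "real i < \<tau> * \<theta> ^ k" using that(2) unfolding m_def by linarith
    then show ?thesis unfolding Z_def using k j that(1) by force
  qed
  have "m \<notin> Z"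
  proof (subst Z_iff[OF k])
    show "\<theta> ^ k \<le> real m" using m j by linarith
    show "real m < \<theta> ^ Suc k" using m gap_length[OF k] by linarith
  qed (use m in simp)
  note tm = tail_free[OF this]
  define d where "d = m - j"
  have d: "m = j + d" "0 < d" using jm by (auto simp: d_def)
  have tj: "tail j = tail m * real B powr (- real d)"
  proof -
    have "tail j = tail m / real B ^ d" unfolding d(1) by (rule tail_zeros) (use in_Z d in auto)
    then show ?thesis using B by (simp add: powr_minus_divide powr_realpow)
  qed
  have "tail j \<le> 1 * real B powr (- real d)"
    unfolding tj using tail_bounds by (intro mult_right_mono) auto
  then have ub: "tail j \<le> real B powr (- real d)" by simp
  also have "\<dots> \<le> real B powr (real j - \<tau> * \<theta> ^ k)"
    using m d by (intro B_powr_mono) simp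
  finally show "pow_dist B \<xi> j \<le> real B powr (real j - \<tau> * \<theta> ^ k)"
    using pow_dist_tail(1)[of j] by linarith
  \<comment> \<open>The tail is at most 1/4, so the nearest integer is the one below and the minimum
    with 1 - \<open>tail j\<close> does no harm.\<close>
  have "real B powr (- real d) \<le> real B powr (- 1)" using d by (intro B_powr_mono) simp
  also have "\<dots> \<le> 1 / 4" using B by (simp add: powr_minus_divide)
  finally have small: "real B powr (- real d) \<le> 1 / 4" .
  have lb: "real B powr (real j - \<tau> * \<theta> ^ k - 2) \<le> real B powr (- real d - 1)"
    using m d by (intro B_powr_mono) simp
  also have "\<dots> = 1 / real B * real B powr (- real d)"
    using B by (simp add: powr_diff)
  also have "\<dots> \<le> tail j" unfolding tj using tm by (intro mult_right_mono) auto
  finally have 1: "real B powr (real j - \<tau> * \<theta> ^ k - 2) \<le> tail j" .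
  then have 2: "real B powr (real j - \<tau> * \<theta> ^ k - 2) \<le> 1 - tail j" using ub small by linarith
  show "real B powr (real j - \<tau> * \<theta> ^ k - 2) \<le> pow_dist B \<xi> j"
    using 1 2 pow_dist_tail(2)[of j] by linarith
qed

text \<open>The zeros left from j number about \<tau> \<theta>^k - j, at most \<theta> w \<theta>^k
  \<le> \<theta> w j; the start of a block is the extreme case.\<close>

lemma cantor_pow_dist_ge: "real B powr (- (\<theta> * w) * real j - 2) \<le> pow_dist B \<xi> j"
proof (cases "j \<in> Z")
  case True
  then obtain k where k: "k0 \<le> k" "\<theta> ^ k \<le> real j" "real j < \<tau> * \<theta> ^ k" unfolding Z_def by blast
  have "\<theta> * w * \<theta> ^ k \<le> \<theta> * w * real j" using k(2) \<theta> w by (intro mult_left_mono) auto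
  then have "- (\<theta> * w) * real j - 2 \<le> real j - \<tau> * \<theta> ^ k - 2"
    using k(2) by (simp add: \<tau>_def algebra_simps)
  then show ?thesis using pow_dist_block(2)[OF k] B_powr_mono order_trans by blast
next
  case False
  have "0 \<le> \<theta> * w * real j" using \<theta> w by simp
  then have "- (\<theta> * w) * real j - 2 \<le> - 1" by simp
  then show ?thesis using pow_dist_free[OF False] B_powr_mono order_trans by blast
qed

lemma block_start:
  assumes "k0 \<le> k"
  obtains j where "\<theta> ^ k \<le> real j" "real j < \<theta> ^ k + 1" "j \<le> nat \<lceil>\<theta> ^ k\<rceil>"
    "pow_dist B \<xi> j \<le> real B powr (1 - \<theta> * w * \<theta> ^ k)"
proof -
  define j where "j = nat \<lceil>\<theta> ^ k\<rceil>"
  have j: "\<theta> ^ k \<le> real j" "real j < \<theta> ^ k + 1"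
    unfolding j_def using theta_power_pos[of k] by linarith+
  have "pow_dist B \<xi> j \<le> real B powr (real j - \<tau> * \<theta> ^ k)"
    using j block_length[OF assms] by (intro pow_dist_block(1) assms) auto
  also have "\<dots> \<le> real B powr (1 - \<theta> * w * \<theta> ^ k)"
    using j by (intro B_powr_mono) (simp add: \<tau>_def algebra_simps)
  finally show ?thesis using that[of j] j by (simp add: j_def)
qed

lemma cantor_pow_dist_often:
  "infinite {j. pow_dist B \<xi> j \<le> real B powr (- (\<theta> * w) * real j + (\<theta> * w + 1))}"
  unfolding infinite_nat_iff_unbounded_le
proof
  fix m
  obtain k1 where "real m < \<theta> ^ k1" using \<theta> real_arch_pow by blast
  then have k: "real m < \<theta> ^ max k0 k1" using theta_power_mono[of k1 "max k0 k1"] by simp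
  obtain j where j: "\<theta> ^ max k0 k1 \<le> real j" "real j < \<theta> ^ max k0 k1 + 1"
    "pow_dist B \<xi> j \<le> real B powr (1 - \<theta> * w * \<theta> ^ max k0 k1)"
    using block_start[of "max k0 k1"] by auto
  have "\<theta> * w * real j \<le> \<theta> * w * (\<theta> ^ max k0 k1 + 1)" using j \<theta> w by (intro mult_left_mono) auto
  then have "1 - \<theta> * w * \<theta> ^ max k0 k1 \<le> - (\<theta> * w) * real j + (\<theta> * w + 1)"
    by (simp add: algebra_simps)
  then have "pow_dist B \<xi> j \<le> real B powr (- (\<theta> * w) * real j + (\<theta> * w + 1))"
    using j(3) B_powr_mono order_trans by blast
  moreover have "m \<le> j" using j k by linarith
  ultimately show "\<exists>n\<ge>m. n \<in> {j. pow_dist B \<xi> j \<le> real B powr (- (\<theta> * w) * real j + (\<theta> * w + 1))}"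
    by blast
qed

text \<open>For \<theta>^k \<le> N < \<theta>^(k+1) the start of block k works, because its length
  \<theta> w \<theta>^k = w \<theta>^(k+1) exceeds w N.\<close>

lemma cantor_pow_dist_uniform:
  "\<exists>n\<le>N. pow_dist B \<xi> n \<le> real B powr (- w * real N + (w * \<theta> ^ k0 + 1))"
proof (cases "\<theta> ^ k0 \<le> real N")
  case False
  then have "w * real N \<le> w * \<theta> ^ k0" using w by (intro mult_left_mono) auto
  then have "real B powr 0 \<le> real B powr (- w * real N + (w * \<theta> ^ k0 + 1))"
    by (intro B_powr_mono) simp
  moreover have "pow_dist B \<xi> 0 \<le> real B powr 0" using pow_dist_le_half[of B \<xi> 0] B by simp
  ultimately show ?thesis by (intro exI[of _ 0]) simp
next
  case True
  then obtain k where k: "k0 \<le> k" "\<theta> ^ k \<le> real N" "real N < \<theta> ^ Suc k"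
    by (rule level_exists)
  obtain j where j: "j \<le> nat \<lceil>\<theta> ^ k\<rceil>" "pow_dist B \<xi> j \<le> real B powr (1 - \<theta> * w * \<theta> ^ k)"
    using block_start[OF k(1)] by blast
  have "w * real N \<le> w * \<theta> ^ Suc k" using k w by (intro mult_left_mono) auto
  moreover have "0 \<le> w * \<theta> ^ k0" using w theta_power_pos[of k0] by simp
  ultimately have "1 - \<theta> * w * \<theta> ^ k \<le> - w * real N + (w * \<theta> ^ k0 + 1)"
    by (simp add: algebra_simps)
  then have "pow_dist B \<xi> j \<le> real B powr (- w * real N + (w * \<theta> ^ k0 + 1))"
    using j(2) B_powr_mono order_trans by blast
  moreover have "j \<le> N" using j(1) k(2) by linarith
  ultimately show ?thesis by blast
qed

lemma cantor_pow_dist_not_uniform: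
  "infinite {N. \<forall>n\<le>N. real B powr (- w * real N - (w + 2)) \<le> pow_dist B \<xi> n}"
  unfolding infinite_nat_iff_unbounded_le
proof
  fix m
  obtain k1 where "real m + 1 < \<theta> ^ k1" using real_arch_pow[OF \<theta>] by blast
  define k where "k = max k0 k1"
  have "\<theta> ^ k1 \<le> \<theta> ^ Suc k" by (rule theta_power_mono) (simp add: k_def)
  then have k: "real m + 1 < \<theta> ^ Suc k" "k0 \<le> k"
    using \<open>real m + 1 < \<theta> ^ k1\<close> by (linarith, simp add: k_def)
  \<comment> \<open>The last integer before block k + 1 may start: only blocks up to k are
    available, and the longest has length w \<theta>^(k+1), about w N.\<close>
  define N where "N = nat (\<lceil>\<theta> ^ Suc k\<rceil> - 1)"
  have N: "m \<le> N" "real N < \<theta> ^ Suc k" "\<theta> ^ Suc k \<le> real N + 1"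
    unfolding N_def using k theta_power_pos[of "Suc k"] by linarith+
  have "real B powr (- w * real N - (w + 2)) \<le> pow_dist B \<xi> n" if "n \<le> N" for n
  proof (cases "n \<in> Z")
    case True
    then obtain l where l: "k0 \<le> l" "\<theta> ^ l \<le> real n" "real n < \<tau> * \<theta> ^ l" unfolding Z_def by blast
    have "\<theta> ^ l < \<theta> ^ Suc k" using l N that by linarith
    then have "l < Suc k" using \<theta> power_less_imp_less_exp by blast
    then have "\<theta> * w * \<theta> ^ l \<le> \<theta> * w * \<theta> ^ k"
      using theta_power_mono[of l k] \<theta> w by (intro mult_left_mono) auto
    moreover have "w * \<theta> ^ Suc k \<le> w * (real N + 1)" using N w by (intro mult_left_mono) auto
    ultimately have "- w * real N - (w + 2) \<le> real n - \<tau> * \<theta> ^ l - 2"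
      using l(2) by (simp add: \<tau>_def algebra_simps)
    then show ?thesis using pow_dist_block(2)[OF l] B_powr_mono order_trans by blast
  next
    case False
    have "0 \<le> w * real N" using w by simp
    then have "- w * real N - (w + 2) \<le> - 1" using w by linarith
    then show ?thesis using pow_dist_free[OF False] B_powr_mono order_trans by blast
  qed
  then show "\<exists>N\<ge>m. N \<in> {N. \<forall>n\<le>N. real B powr (- w * real N - (w + 2)) \<le> pow_dist B \<xi> n}"
    using N(1) by blast
qed

end

end

section \<open>The dimension formula\<close>

context dense_sequence
begin

text \<open>The condition on s is strict, hence stable under a small perturbation of the exponents,
  and \<open>hausdorff_measure_null\<close> then applies to countably many pieces.\<close>

lemma uniform_sets_null:
  assumes w: "0 < w" "w < v" and s: "0 < s" "1 - w * v / (v - w) < s * (1 + v)"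
  shows "hausdorff_measure s (V_hat b a (ereal w) \<inter> V_star b a (ereal v)) = 0"
proof -
  \<comment> \<open>Positivity of \<open>f \<epsilon>\<close> is the condition of
    \<open>hausdorff_measure_null\<close> for the exponents w - \<epsilon>, v + \<epsilon>, v -
    \<epsilon>.\<close>
  define f where "f = (\<lambda>\<epsilon>. s * (1 + (v - \<epsilon>)) - (1 - (w - \<epsilon>) * (v + \<epsilon>) / ((v + \<epsilon>) - (w - \<epsilon>))))"
  have "(f \<longlongrightarrow> s * (1 + (v - 0)) - (1 - (w - 0) * (v + 0) / ((v + 0) - (w - 0)))) (at_right 0)"
    unfolding f_def using w by (intro tendsto_intros) auto
  moreover have "0 < s * (1 + (v - 0)) - (1 - (w - 0) * (v + 0) / ((v + 0) - (w - 0)))"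
    using s by simp
  ultimately have "\<forall>\<^sub>F \<epsilon> in at_right 0. 0 < f \<epsilon>" by (rule order_tendstoD)
  moreover have "\<forall>\<^sub>F \<epsilon> in at_right 0. \<epsilon> < w"
    using w by (simp add: eventually_at_right_less order_tendstoD(2)[OF tendsto_ident_at])
  moreover have "\<forall>\<^sub>F \<epsilon> in at_right (0::real). 0 < \<epsilon>" by (rule eventually_at_right_less)
  ultimately have "\<forall>\<^sub>F \<epsilon> in at_right 0. 0 < f \<epsilon> \<and> \<epsilon> < w \<and> 0 < \<epsilon>" by eventually_elim simp
  then obtain \<epsilon> where \<epsilon>: "0 < f \<epsilon>" "\<epsilon> < w" "0 < \<epsilon>"
    using eventually_happens'[OF trivial_limit_at_right_real] by blast
  define E where "E = (\<lambda>q::nat. {\<xi>. \<xi> \<in> V_hat b a (ereal w) \<inter> V_star b a (ereal v) \<and> \<bar>\<xi>\<bar> \<le> real q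
      \<and> (\<forall>n. real b powr (- (v + \<epsilon>) * real n - real q) \<le> pow_dist b \<xi> n)
      \<and> (\<forall>N. \<exists>n\<le>N. pow_dist b \<xi> n < real b powr (- (w - \<epsilon>) * real N + real q))})"
  have "hausdorff_measure s (E q) = 0" for q
  proof -
    interpret uniform_approx b "w - \<epsilon>" "v + \<epsilon>" "v - \<epsilon>" "real q" "E q"
    proof
      fix \<xi> assume "\<xi> \<in> E q"
      then have "ereal v \<le> v_exp b a \<xi>" by (simp add: E_def V_star_def)
      then show "infinite {n. pow_dist b \<xi> n < real b powr (- (v - \<epsilon>) * real n)}"
        using \<epsilon> by (intro v_exp_lowerD) auto
    qed (use b w \<epsilon> in \<open>auto simp: E_def\<close>)
    show ?thesis
      using \<epsilon>(1) s(1) by (intro hausdorff_measure_null) (auto simp: f_def)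
  qed
  then have "hausdorff_measure s (\<Union>q. E q) = 0" by (rule hausdorff_measure_UN_null)
  moreover have "V_hat b a (ereal w) \<inter> V_star b a (ereal v) \<subseteq> (\<Union>q. E q)"
  proof
    fix \<xi> assume \<xi>: "\<xi> \<in> V_hat b a (ereal w) \<inter> V_star b a (ereal v)"
    obtain q1 where q1: "\<And>n. real b powr (- (v + \<epsilon>) * real n - q1) \<le> pow_dist b \<xi> n"
      using v_exp_upperD[of \<xi> v "v + \<epsilon>"] \<xi> w \<epsilon> by (auto simp: V_star_def)
    have "ereal w \<le> v_hat_exp b a \<xi>" using \<xi> by (simp add: V_hat_def)
    then obtain q2 where "0 \<le> q2" and q2: "\<And>N. \<exists>n\<le>N. pow_dist b \<xi> n < real b powr (- (w - \<epsilon>) * real N + q2)"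
      by (rule v_hat_exp_lowerD[of w \<xi> "w - \<epsilon>"]) (use \<epsilon> in auto)
    define q where "q = nat \<lceil>max \<bar>\<xi>\<bar> (max q1 q2)\<rceil>"
    have q: "\<bar>\<xi>\<bar> \<le> real q" "q1 \<le> real q" "q2 \<le> real q" unfolding q_def by linarith+
    have "real b powr (- (v + \<epsilon>) * real n - real q) \<le> pow_dist b \<xi> n" for n
      using q(2) by (intro order_trans[OF powr_mono' q1]) simp
    moreover have "\<exists>n\<le>N. pow_dist b \<xi> n < real b powr (- (w - \<epsilon>) * real N + real q)" for N
    proof -
      obtain n where n: "n \<le> N" "pow_dist b \<xi> n < real b powr (- (w - \<epsilon>) * real N + q2)"
        using q2 by blast
      note n(2)
      also have "real b powr (- (w - \<epsilon>) * real N + q2) \<le> real b powr (- (w - \<epsilon>) * real N + real q)"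
        using q(3) by (intro powr_mono') simp
      finally show ?thesis using n(1) by blast
    qed
    ultimately have "\<xi> \<in> E q" unfolding E_def using \<xi> q(1) by blast
    then show "\<xi> \<in> (\<Union>q. E q)" by blast
  qed
  ultimately show ?thesis by (rule hausdorff_measure_null_mono[rotated])
qed

text \<open>Pulls lower bounds known only at multiples of D back to all positions, at the bounded
  cost b^D.\<close>

lemma pow_dist_ge_multiple:
  assumes "0 < D"
  shows "real b powr (- real D) * pow_dist b \<xi> (D * Suc (n div D)) \<le> pow_dist b \<xi> n"
proof -
  have D: "n \<le> D * Suc (n div D)" "D * Suc (n div D) \<le> n + D"
    using assms mult_div_mod_eq[of D n] mod_less_divisor[OF assms, of n] by (simp_all, linarith+)
  have "pow_dist b \<xi> (D * Suc (n div D)) \<le> real b powr (real (D * Suc (n div D)) - real n) * pow_dist b \<xi> n"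
    using D(1) by (rule pow_dist_le)
  also have "\<dots> \<le> real b powr real D * pow_dist b \<xi> n"
    using D by (intro mult_right_mono powr_mono' pow_dist_nonneg) linarith
  finally have "real b powr (- real D) * pow_dist b \<xi> (D * Suc (n div D))
      \<le> real b powr (- real D) * (real b powr real D * pow_dist b \<xi> n)"
    by (intro mult_left_mono) auto
  moreover have "real b powr (- real D) * real b powr real D = 1"
    using b by (simp flip: powr_add)
  ultimately show ?thesis unfolding mult.assoc[symmetric] by simp
qed

text \<open>Position j in base b^D is position D j in base b, and both sides of the estimates
  rescale alike, so the exponents are unchanged; only additive constants grow with D.\<close>

lemma cantor_subset:
  assumes "zero_blocks (b ^ D) k0 \<theta> w \<kappa>"
  shows "digit_cantor.cantor (b ^ D) (zero_blocks.Z k0 \<theta> w)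
    \<subseteq> V_hat_star b a (ereal w) \<inter> V_star b a (ereal (\<theta> * w))"
proof
  interpret zero_blocks "b ^ D" k0 \<theta> w \<kappa> by (rule assms)
  fix \<xi> assume "\<xi> \<in> cantor"
  then obtain y where y: "\<And>j. y j < b ^ D - 2" and \<xi>: "\<xi> = digit_val (b ^ D) (free_embed y)"
    unfolding cantor_def by blast
  have D: "0 < D" using B by (cases D) auto
  define v where "v = \<theta> * w"
  have v: "0 < v" using \<theta> w by (simp add: v_def)
  have powB: "real (b ^ D) powr x = real b powr (real D * x)" for x
    using b by (simp add: powr_powr flip: powr_realpow)
  note dist_ge = cantor_pow_dist_ge[where y=y, OF y, folded \<xi> v_def, unfolded pow_dist_power_base powB]
  note often = cantor_pow_dist_often[where y=y, OF y, folded \<xi> v_def, unfolded pow_dist_power_base powB]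
  note uniform = cantor_pow_dist_uniform[where y=y, OF y, folded \<xi>, unfolded pow_dist_power_base powB]
  note not_uniform = cantor_pow_dist_not_uniform[where y=y, OF y, folded \<xi>, unfolded pow_dist_power_base powB]
  have "v_exp b a \<xi> \<le> ereal v"
  proof (rule v_exp_leI)
    fix n
    define j where "j = Suc (n div D)"
    have "D * j \<le> n + D" using D by (simp add: j_def)
    then have "real D * real j \<le> real n + real D" by (simp flip: of_nat_mult of_nat_add)
    then have "v * (real D * real j) \<le> v * (real n + real D)" using v by (intro mult_left_mono) auto
    then have "- v * real n - (v * real D + 3 * real D) \<le> - real D + real D * (- v * real j - 2)"
      by (simp add: algebra_simps)
    then have "real b powr (- v * real n - (v * real D + 3 * real D))
        \<le> real b powr (- real D) * real b powr (real D * (- v * real j - 2))"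
      unfolding powr_add[symmetric] by (rule powr_mono')
    also have "\<dots> \<le> real b powr (- real D) * pow_dist b \<xi> (D * j)"
      by (intro mult_left_mono dist_ge) auto
    also have "\<dots> \<le> pow_dist b \<xi> n" unfolding j_def using D by (rule pow_dist_ge_multiple)
    finally show "real b powr (- v * real n - (v * real D + 3 * real D)) \<le> pow_dist b \<xi> n" .
  qed
  moreover have "ereal v \<le> v_exp b a \<xi>"
  proof (rule v_exp_geI[OF v])
    let ?S = "{j. pow_dist b \<xi> (D * j) \<le> real b powr (real D * (- v * real j + (v + 1)))}"
    have "inj_on ((*) D) ?S" using D by (intro inj_onI) simp
    then have "infinite ((*) D ` ?S)" using often finite_imageD by blast
    moreover have "(*) D ` ?S \<subseteq> {n. pow_dist b \<xi> n \<le> real b powr (- v * real n + real D * (v + 1))}"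
      by (auto simp: algebra_simps)
    ultimately show "infinite {n. pow_dist b \<xi> n \<le> real b powr (- v * real n + real D * (v + 1))}"
      using finite_subset by blast
  qed
  moreover have "ereal w \<le> v_hat_exp b a \<xi>"
  proof (rule v_hat_exp_geI[OF w])
    fix N
    let ?q = "w * \<theta> ^ k0 + 1"
    obtain n where n: "n \<le> N div D" "pow_dist b \<xi> (D * n) \<le> real b powr (real D * (- w * real (N div D) + ?q))"
      using uniform by blast
    have "N \<le> D * (N div D) + D" using D mult_div_mod_eq[of D N] mod_less_divisor[OF D, of N] by linarith
    then have "real N \<le> real D * real (N div D) + real D" by (simp flip: of_nat_mult of_nat_add)
    then have "w * real N \<le> w * (real D * real (N div D) + real D)" using w by (intro mult_left_mono) auto
    then have "real D * (- w * real (N div D) + ?q) \<le> - w * real N + (w * real D + real D * ?q)"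
      by (simp add: algebra_simps)
    then have "pow_dist b \<xi> (D * n) \<le> real b powr (- w * real N + (w * real D + real D * ?q))"
      using n(2) powr_mono' order_trans by blast
    moreover have "D * n \<le> N" using n(1) D by (simp add: less_eq_div_iff_mult_less_eq mult.commute)
    ultimately show "\<exists>n\<le>N. pow_dist b \<xi> n \<le> real b powr (- w * real N + (w * real D + real D * ?q))"
      by blast
  qed
  moreover have "v_hat_exp b a \<xi> \<le> ereal w"
  proof (rule v_hat_exp_leI[OF w])
    let ?q = "real D + w + real D * (w + 2)"
    show "infinite {N. \<forall>n\<le>N. real b powr (- w * real N - ?q) \<le> pow_dist b \<xi> n}"
      unfolding infinite_nat_iff_unbounded_le
    proof
      fix m
      obtain J where J: "Suc m \<le> J"
        "\<And>n. n \<le> J \<Longrightarrow> real b powr (real D * (- w * real J - (w + 2))) \<le> pow_dist b \<xi> (D * n)"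
        using not_uniform unfolding infinite_nat_iff_unbounded_le by blast
      have DJ: "J \<le> D * J" using D by simp
      \<comment> \<open>With D J - 1 in place of D J, the next multiple of D strictly above n is
        still at most D J.\<close>
      have "real b powr (- w * real (D * J - 1) - ?q) \<le> pow_dist b \<xi> n" if "n \<le> D * J - 1" for n
      proof -
        have "n < D * J" using that DJ J(1) by linarith
        then have "Suc (n div D) \<le> J" using D by (simp add: Suc_le_eq div_less_iff_less_mult mult.commute)
        have DJ': "real (D * J - 1) = real D * real J - 1" using DJ J(1) by (simp add: of_nat_diff)
        have "- w * real (D * J - 1) - ?q = - real D + real D * (- w * real J - (w + 2))"
          unfolding DJ' by (simp add: algebra_simps)
        then have "real b powr (- w * real (D * J - 1) - ?q)
            = real b powr (- real D) * real b powr (real D * (- w * real J - (w + 2)))"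
          by (simp only: powr_add[symmetric])
        also have "\<dots> \<le> real b powr (- real D) * pow_dist b \<xi> (D * Suc (n div D))"
          by (intro mult_left_mono J \<open>Suc (n div D) \<le> J\<close>) auto
        also have "\<dots> \<le> pow_dist b \<xi> n" using D by (rule pow_dist_ge_multiple)
        finally show ?thesis .
      qed
      moreover have "m \<le> D * J - 1" using DJ J(1) by linarith
      ultimately show "\<exists>N\<ge>m. N \<in> {N. \<forall>n\<le>N. real b powr (- w * real N - ?q) \<le> pow_dist b \<xi> n}"
        by blast
    qed
  qed
  ultimately show "\<xi> \<in> V_hat_star b a (ereal w) \<inter> V_star b a (ereal (\<theta> * w))"
    by (simp add: V_hat_star_def V_star_def v_def)
qed

text \<open>Two approximations share the slack below the target: \<kappa> below the limiting density
  (\<theta> - \<sigma>) / (\<theta> - 1), and a large base to offset the two excluded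
  digits.\<close>

lemma hausdorff_dim_ge:
  assumes w: "0 < w" and \<theta>: "1 < \<theta>" "1 + \<theta> * w < \<theta>"
    and s: "0 < s" "s < (\<theta> - 1 - \<theta> * w) / ((\<theta> - 1) * (1 + \<theta> * w))"
  shows "ereal s \<le> hausdorff_dim (V_hat_star b a (ereal w) \<inter> V_star b a (ereal (\<theta> * w)))"
proof -
  define \<sigma> where "\<sigma> = 1 + \<theta> * w"
  have \<sigma>: "1 < \<sigma>" "\<sigma> < \<theta>" using w \<theta> by (auto simp: \<sigma>_def)
  have "s * \<sigma> < (\<theta> - \<sigma>) / (\<theta> - 1)"
    using s(2) \<sigma> \<theta>(1) by (simp add: \<sigma>_def[symmetric] diff_diff_eq field_simps)
  then obtain \<kappa> where \<kappa>: "s * \<sigma> < \<kappa>" "\<kappa> < (\<theta> - \<sigma>) / (\<theta> - 1)" using dense by blast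
  have \<kappa>0: "0 < \<kappa>" using \<kappa>(1) s(1) \<sigma> by (meson less_trans mult_pos_pos zero_less_one)
  have slope: "0 < \<theta> - \<sigma> - \<kappa> * (\<theta> - 1)" using \<kappa>(2) \<theta>(1) by (simp add: pos_less_divide_eq)
  \<comment> \<open>Large enough that losing the proportion 1 / D of \<kappa> still leaves at least
    s \<sigma>.\<close>
  obtain D0 :: nat where "\<kappa> / (\<kappa> - s * \<sigma>) < real D0" using reals_Archimedean2 by blast
  define D where "D = max 2 D0"
  have D: "2 \<le> D" "\<kappa> / (\<kappa> - s * \<sigma>) < real D" using \<open>_ < real D0\<close> by (auto simp: D_def)
  have ratio: "s \<le> (1 - 1 / real D) * (\<kappa> / \<sigma>)"
  proof -
    have "\<kappa> < real D * (\<kappa> - s * \<sigma>)" using D(2) \<kappa>(1) by (simp add: pos_divide_less_eq)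
    then have "s * \<sigma> \<le> (1 - 1 / real D) * \<kappa>" using D(1) by (simp add: field_simps)
    then show ?thesis using \<sigma> by (simp add: pos_le_divide_eq)
  qed
  define B where "B = b ^ D"
  have "b ^ 2 \<le> B" unfolding B_def using D(1) b by (intro power_increasing) auto
  moreover have "2 ^ 2 \<le> b ^ 2" using b by (intro power_mono) auto
  ultimately have B: "4 \<le> B" by simp
  obtain k1 where k1: "1 / (\<theta> - \<sigma> - \<kappa> * (\<theta> - 1)) < \<theta> ^ k1" using real_arch_pow[OF \<theta>(1)] by blast
  obtain k2 where k2: "1 / (\<theta> * w) < \<theta> ^ k2" using real_arch_pow[OF \<theta>(1)] by blast
  define k0 where "k0 = max k1 k2"
  have "\<theta> ^ k1 \<le> \<theta> ^ k0" "\<theta> ^ k2 \<le> \<theta> ^ k0" using \<theta>(1) by (auto simp: k0_def intro!: power_increasing)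
  then have "1 / (\<theta> - \<sigma> - \<kappa> * (\<theta> - 1)) < \<theta> ^ k0" "1 / (\<theta> * w) < \<theta> ^ k0" using k1 k2 by linarith+
  then have k0: "1 \<le> (\<theta> - \<sigma> - \<kappa> * (\<theta> - 1)) * \<theta> ^ k0" "1 < \<theta> * w * \<theta> ^ k0"
    using slope w \<theta>(1) by (simp_all add: pos_divide_less_eq mult.commute)
  have zb: "zero_blocks B k0 \<theta> w \<kappa>"
    using B w \<theta> \<kappa>0 k0 by unfold_locales (auto simp: \<sigma>_def)
  interpret zero_blocks B k0 \<theta> w \<kappa> by (rule zb)
  define A where "A = \<kappa> * \<theta> ^ k0 + 1"
  have A: "0 \<le> A" using \<kappa>0 \<theta>(1) by (simp add: A_def)
  have rank_ge: "1 / real (B - 2) ^ free_rank n \<le> real B powr A * real B powr (- s * real n)" for n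
  proof -
    \<comment> \<open>With B = b^D this gives B - 2 \<ge> B / 2 \<ge> B^(1 - 1 / D), an explicit
      form of the loss log (B - 2) / log B.\<close>
    have "real B powr (1 - 1 / real D) = real B / real b"
      using b D(1) by (simp add: B_def powr_diff powr_powr flip: powr_realpow)
    also have "\<dots> \<le> real B / 2" using b by (intro divide_left_mono) auto
    also have "\<dots> \<le> real (B - 2)" using B by (simp add: of_nat_diff)
    finally have "(real B powr (1 - 1 / real D)) ^ free_rank n \<le> real (B - 2) ^ free_rank n"
      by (intro power_mono) auto
    then have 1: "real B powr ((1 - 1 / real D) * real (free_rank n)) \<le> real (B - 2) ^ free_rank n"
      using B by (simp add: powr_power mult.commute)
    have "s * real n \<le> (1 - 1 / real D) * (\<kappa> / \<sigma>) * real n"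
      using ratio by (intro mult_right_mono) auto
    moreover have "(1 - 1 / real D) * A \<le> 1 * A" using A D(1) by (intro mult_right_mono) auto
    moreover have "(1 - 1 / real D) * (\<kappa> / \<sigma> * real n - A) \<le> (1 - 1 / real D) * real (free_rank n)"
      using D(1) free_rank_ge[of n] unfolding A_def \<sigma>_def \<tau>_def
      by (intro mult_left_mono) auto
    ultimately have "s * real n - A \<le> (1 - 1 / real D) * real (free_rank n)"
      by (simp add: right_diff_distrib mult.assoc)
    then have "real B powr (s * real n - A) \<le> real B powr ((1 - 1 / real D) * real (free_rank n))"
      by (rule B_powr_mono)
    then have "real B powr (s * real n - A) \<le> real (B - 2) ^ free_rank n" using 1 by linarith
    then have "1 / real (B - 2) ^ free_rank n \<le> 1 / real B powr (s * real n - A)"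
      using B by (intro divide_left_mono) auto
    also have "\<dots> = real B powr A * real B powr (- s * real n)"
      by (simp add: powr_minus_divide[symmetric] powr_add[symmetric])
    finally show ?thesis .
  qed
  have "hausdorff_measure s cantor \<noteq> 0"
    using s(1) _ rank_ge by (rule hausdorff_measure_cantor) (use B in simp)
  then have "ereal s \<le> hausdorff_dim cantor" by (rule hausdorff_dim_geI)
  also have "\<dots> \<le> hausdorff_dim (V_hat_star b a (ereal w) \<inter> V_star b a (ereal (\<theta> * w)))"
    using cantor_subset[of D k0 \<theta> w \<kappa>] zb unfolding B_def by (intro hausdorff_dim_mono) auto
  finally show ?thesis .
qed

end

theorem theorem1p7:
  fixes b :: nat and a :: "nat \<Rightarrow> nat" and w \<theta> :: real
  assumes "2 \<le> b"
    and "strict_mono_on {1..} a"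
    and "\<And>n. 1 \<le> n \<Longrightarrow> 0 < a n"
    and "growth_ratio a < \<infinity>"
    and "growth_ratio a = 1"
    and "0 < w" and "w < 1"
    and "1 / (1 - w) \<le> \<theta>"
  shows "hausdorff_dim (V_hat_star b a (ereal w) \<inter> V_star b a (ereal (\<theta> * w)))
           = hausdorff_dim (V_hat b a (ereal w) \<inter> V_star b a (ereal (\<theta> * w)))
       \<and> hausdorff_dim (V_hat b a (ereal w) \<inter> V_star b a (ereal (\<theta> * w)))
           = ereal ((\<theta> - 1 - \<theta> * w) / ((\<theta> - 1) * (1 + \<theta> * w)))"
proof -
  interpret dense_sequence b a
    by unfold_locales (use assms in auto)
  define E1 where "E1 = V_hat_star b a (ereal w) \<inter> V_star b a (ereal (\<theta> * w))"
  define E2 where "E2 = V_hat b a (ereal w) \<inter> V_star b a (ereal (\<theta> * w))"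
  define s0 where "s0 = (\<theta> - 1 - \<theta> * w) / ((\<theta> - 1) * (1 + \<theta> * w))"
  have "1 < 1 / (1 - w)" using assms(6,7) by simp
  then have \<theta>: "1 < \<theta>" using assms(8) by linarith
  have num: "0 \<le> \<theta> - 1 - \<theta> * w" using assms(7,8) by (simp add: field_simps)
  have v: "0 < \<theta> * w" "w < \<theta> * w" using \<theta> assms(6) by simp_all
  have s0: "0 \<le> s0" unfolding s0_def using num \<theta> v by (intro divide_nonneg_nonneg) auto
  have "hausdorff_dim E2 \<le> ereal s0"
  proof (rule hausdorff_dim_leI[OF s0])
    fix t assume t: "s0 < t"
    \<comment> \<open>With v = \<theta> w the growth rate of the prefixes is the claimed dimension
      times 1 + \<theta> w.\<close>
    have "1 - w * (\<theta> * w) / (\<theta> * w - w) = s0 * (1 + \<theta> * w)"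
    proof -
      have "\<theta> * w - w = w * (\<theta> - 1)" by (simp add: algebra_simps)
      then have "w * (\<theta> * w) / (\<theta> * w - w) = \<theta> * w / (\<theta> - 1)" using assms(6) by simp
      moreover have "s0 * (1 + \<theta> * w) = (\<theta> - 1 - \<theta> * w) / (\<theta> - 1)" using v by (simp add: s0_def)
      moreover have "\<dots> = 1 - \<theta> * w / (\<theta> - 1)" using \<theta> by (simp add: diff_divide_distrib)
      ultimately show ?thesis by simp
    qed
    also have "\<dots> < t * (1 + \<theta> * w)" using t v by simp
    finally show "hausdorff_measure t E2 = 0"
      unfolding E2_def using assms(6) v s0 t by (intro uniform_sets_null) auto
  qed
  moreover have "hausdorff_dim E1 \<le> hausdorff_dim E2"
    unfolding E1_def E2_def V_hat_star_def V_hat_def by (intro hausdorff_dim_mono) auto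
  moreover have "ereal s0 \<le> hausdorff_dim E1"
  proof (rule ccontr)
    assume "\<not> ereal s0 \<le> hausdorff_dim E1"
    then obtain d where d: "hausdorff_dim E1 = ereal d" "0 \<le> d" "d < s0"
      using hausdorff_dim_nonneg[of E1] by (cases "hausdorff_dim E1") auto
    then have "0 < (d + s0) / 2" "(d + s0) / 2 < s0" "d < (d + s0) / 2" by simp_all
    \<comment> \<open>At the endpoint \<theta> = 1 / (1 - w) the blocks would leave no gaps, but
      there \<open>s0\<close> = 0, which contradicts 0 \<le> d < \<open>s0\<close>.\<close>
    moreover have "1 + \<theta> * w < \<theta>"
      using d num by (cases "\<theta> - 1 - \<theta> * w = 0") (auto simp: s0_def)
    ultimately have "ereal ((d + s0) / 2) \<le> ereal d"
      using hausdorff_dim_ge[OF assms(6) \<theta>, of "(d + s0) / 2"] d(1) unfolding s0_def E1_def by simp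
    then show False using \<open>d < (d + s0) / 2\<close> by simp
  qed
  ultimately show ?thesis unfolding E1_def E2_def s0_def by (meson order_antisym order_trans)
qed

end
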